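(* Let $1\le g<h$ be integers. Suppose $\mathcal{D}_A\subseteq SM(\mathbb{R})^h$ is a bounded real free spectrahedron, and let $F$ be a $g$-dimensional face of $\mathcal{D}_A(1)$. Then $X\in\mathrm{gr}_{\mathcal{D}_A}(F)$ is a free extreme point of $\mathrm{gr}_{\mathcal{D}_A}(F)$ if and only if $X$ is a free extreme point of $\mathcal{D}_A$.
   Context: All matrices are real. $SM_n(\mathbb{R})^h$ is the set of $h$-tuples of real symmetric $n\times n$ matrices, $SM(\mathbb{R})^h=\bigcup_{n\ge1}SM_n(\mathbb{R})^h$, and for $K\subseteq SM(\mathbb{R})^h$, $K(n)=K\cap SM_n(\mathbb{R})^h$. For a matrix $V$, $V^TXV=(V^TX_1V,\dots,V^TX_hV)$. $X\sim_u Y$ means $U^TXU=Y$ for some real orthogonal matrix $U$. Direct sums of tuples are coordinatewise. A matrix convex combination of elements of $K$ is a finite sum $\sum_{\ell=1}^m V_\ell^TX^\ell V_\ell$ with $X^\ell\in K(n_\ell)$, $V_\ell\in M_{n_\ell\times n}(\mathbb{R})$, $\sum_\ell V_\ell^TV_\ell=I_n$. The matrix convex hull $\mathrm{co}^{\mathrm{mat}}(K)$ is the set of all matrix convex combinations of elements of $K$; $K$ is matrix convex if $K=\mathrm{co}^{\mathrm{mat}}(K)$. $K$ is bounded if there is $C>0$ with $CI-\sum_iX_i^2\succeq0$ for all $X\in K$. For $A\in SM_d(\mathbb{R})^h$, the free spectrahedron is $\mathcal{D}_A=\{X\in SM(\mathbb{R})^h: L_A(X)\succeq0\}$, where for $X\in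 SM_n(\mathbb{R})^h$, $L_A(X)=I_{dn}-A_1\otimes X_1-\dots-A_h\otimes X_h$ ($\otimes$ is the Kronecker product). A free spectrahedron is matrix convex. A point $X\in K(n)$ of a matrix convex set $K$ is a free extreme point of $K$ if whenever $X=\sum_{\ell=1}^m V_\ell^TY^\ell V_\ell$ is a matrix convex combination of $Y^\ell\in K(n_\ell)$ with every $V_\ell\ne0$, then for each $\ell$ either $n_\ell=n$ and $X\sim_uY^\ell$, or $n_\ell>n$ and there is $Z^\ell\in K$ with $X\oplus Z^\ell\sim_uY^\ell$. A subset $F$ of a convex set $C\subseteq\mathbb{R}^h$ is a face if whenever $x,y\in C$ and $tx+(1-t)y\in F$ for some $t\in(0,1)$, then $x,y\in F$. The dimension of $F$ is that of its affine hull $\mathrm{aff}(F)$. Graded lift: the matrix affine hull of $F$ is $\mathrm{aff}^{\mathrm{mat}}(F)=\mathrm{co}^{\mathrm{mat}}(\mathrm{aff}(F))\subseteq SM(\mathbb{R})^h$. For a closed matrix convex set $K\subseteq SM(\mathbb{R})^h$ (each $K(n)$ closed) and a face $F$ of $K(1)$, the graded lift of $F$ with respect to $K$ is $\mathrm{gr}_K(F)=\mathrm{aff}^{\mathrm{mat}}(F)\cap K$.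
   Formalization: The face F is additionally required to be convex (the standard notion of face); for an arbitrary subset with the segment property, such as three vertices of a 3-dimensional polytope whose plane cuts another edge, the claim fails. *)

theory Defs
  imports "HOL-Analysis.Analysis" "Jordan_Normal_Form.Matrix"
begin

unbundle no vec_syntax
hide_const (open) Finite_Cartesian_Product.mat

text \<open>
  The sizes of the matrices vary within one and the same notion, so matrices are the
  explicitly sized \<open>real mat\<close>; the number of coordinates h is fixed throughout, so a tuple is a
  function \<open>'h \<Rightarrow> real mat\<close> on a finite index type with h = CARD('h).
\<close>

definition SM_level :: "nat \<Rightarrow> ('h \<Rightarrow> real mat) set" where
  "SM_level n = {X. \<forall>i. X i \<in> carrier_mat n n \<and> transpose_mat (X i) = X i}"

definition level :: "('h \<Rightarrow> real mat) set \<Rightarrow> nat \<Rightarrow> ('h \<Rightarrow> real mat) set" where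
  "level K n = K \<inter> SM_level n"

text \<open>The type \<open>real mat\<close> is no additive monoid, so finite sums of n \<times> n matrices are taken entrywise.\<close>

definition mat_sum :: "nat \<Rightarrow> ('l \<Rightarrow> real mat) \<Rightarrow> 'l set \<Rightarrow> real mat" where
  "mat_sum n M I = mat n n (\<lambda>(r, s). \<Sum>l\<in>I. M l $$ (r, s))"

definition psd :: "real mat \<Rightarrow> bool" where
  "psd M \<longleftrightarrow> M \<in> carrier_mat (dim_row M) (dim_row M) \<and> transpose_mat M = M \<and>
     (\<forall>v\<in>carrier_vec (dim_row M). 0 \<le> v \<bullet> (M *\<^sub>v v))"

definition kronecker :: "real mat \<Rightarrow> real mat \<Rightarrow> real mat" where
  "kronecker P Q = mat (dim_row P * dim_row Q) (dim_col P * dim_col Q)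
     (\<lambda>(r, s). P $$ (r div dim_row Q, s div dim_col Q) * Q $$ (r mod dim_row Q, s mod dim_col Q))"

definition compress :: "real mat \<Rightarrow> ('h \<Rightarrow> real mat) \<Rightarrow> 'h \<Rightarrow> real mat" where
  "compress V X = (\<lambda>i. transpose_mat V * X i * V)"

definition direct_sum :: "('h \<Rightarrow> real mat) \<Rightarrow> ('h \<Rightarrow> real mat) \<Rightarrow> 'h \<Rightarrow> real mat" where
  "direct_sum X Z = (\<lambda>i. diag_block_mat [X i, Z i])"

text \<open>
  Orthogonality is spelled out because \<open>orthogonal_mat\<close> of the matrix library only asks for
  the columns to be nonzero and pairwise orthogonal.
\<close>

definition orth_equiv :: "('h \<Rightarrow> real mat) \<Rightarrow> ('h \<Rightarrow> real mat) \<Rightarrow> bool" (infix \<open>\<sim>\<^sub>u\<close> 50) where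
  "X \<sim>\<^sub>u Y \<longleftrightarrow> (\<exists>n U. (\<forall>i. X i \<in> carrier_mat n n) \<and> U \<in> carrier_mat n n \<and>
     transpose_mat U * U = 1\<^sub>m n \<and> compress U X = Y)"

text \<open>
  \<open>mat_conv_comb K n m N V Y X\<close>: the n \<times> n tuple X is the matrix convex combination of the m
  tuples Y l of size N l in K with coefficients V l, for l < m.
\<close>

definition mat_conv_comb ::
  "('h \<Rightarrow> real mat) set \<Rightarrow> nat \<Rightarrow> nat \<Rightarrow> (nat \<Rightarrow> nat) \<Rightarrow> (nat \<Rightarrow> real mat)
     \<Rightarrow> (nat \<Rightarrow> 'h \<Rightarrow> real mat) \<Rightarrow> ('h \<Rightarrow> real mat) \<Rightarrow> bool" where
  "mat_conv_comb K n m N V Y X \<longleftrightarrow>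
     (\<forall>l<m. Y l \<in> level K (N l) \<and> V l \<in> carrier_mat (N l) n) \<and>
     mat_sum n (\<lambda>l. transpose_mat (V l) * V l) {..<m} = 1\<^sub>m n \<and>
     X = (\<lambda>i. mat_sum n (\<lambda>l. compress (V l) (Y l) i) {..<m})"

definition co_mat :: "('h \<Rightarrow> real mat) set \<Rightarrow> ('h \<Rightarrow> real mat) set" where
  "co_mat K = {X. \<exists>n\<ge>1. \<exists>m N V Y. mat_conv_comb K n m N V Y X}"

definition mat_bounded :: "('h::finite \<Rightarrow> real mat) set \<Rightarrow> bool" where
  "mat_bounded K \<longleftrightarrow> (\<exists>C>0. \<forall>n\<ge>1. \<forall>X\<in>level K n.
     psd (C \<cdot>\<^sub>m 1\<^sub>m n - mat_sum n (\<lambda>i. X i * X i) UNIV))"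

definition pencil :: "nat \<Rightarrow> ('h::finite \<Rightarrow> real mat) \<Rightarrow> nat \<Rightarrow> ('h \<Rightarrow> real mat) \<Rightarrow> real mat" where
  "pencil d A n X = 1\<^sub>m (d * n) - mat_sum (d * n) (\<lambda>i. kronecker (A i) (X i)) UNIV"

definition free_spectrahedron :: "nat \<Rightarrow> ('h::finite \<Rightarrow> real mat) \<Rightarrow> ('h \<Rightarrow> real mat) set" where
  "free_spectrahedron d A = (\<Union>n\<in>{1..}. {X \<in> SM_level n. psd (pencil d A n X)})"

text \<open>Used for matrix convex K only.\<close>

definition free_extreme_point :: "('h \<Rightarrow> real mat) set \<Rightarrow> ('h \<Rightarrow> real mat) \<Rightarrow> bool" where
  "free_extreme_point K X \<longleftrightarrow> (\<exists>n\<ge>1. X \<in> level K n \<and>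
     (\<forall>m N V Y. mat_conv_comb K n m N V Y X \<and> (\<forall>l<m. V l \<noteq> 0\<^sub>m (N l) n) \<longrightarrow>
        (\<forall>l<m. (N l = n \<and> X \<sim>\<^sub>u Y l) \<or>
               (N l > n \<and> (\<exists>Z\<in>K. direct_sum X Z \<sim>\<^sub>u Y l)))))"

text \<open>
  A point of real h-space is identified with an h-tuple of 1 \<times> 1 matrices, so that K(1) becomes
  a set in Euclidean space, where affine hulls, faces and dimension are those of the library.
\<close>

definition scalar_tuple :: "real ^ 'h \<Rightarrow> 'h \<Rightarrow> real mat" where
  "scalar_tuple x = (\<lambda>i. mat 1 1 (\<lambda>_. vec_nth x i))"

definition level_one :: "('h \<Rightarrow> real mat) set \<Rightarrow> (real ^ 'h) set" where
  "level_one K = {x. scalar_tuple x \<in> K}"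

definition aff_mat :: "(real ^ 'h) set \<Rightarrow> ('h::finite \<Rightarrow> real mat) set" where
  "aff_mat F = co_mat (scalar_tuple ` (affine hull F))"

definition graded_lift :: "('h \<Rightarrow> real mat) set \<Rightarrow> (real ^ 'h) set \<Rightarrow> ('h::finite \<Rightarrow> real mat) set" where
  "graded_lift K F = aff_mat F \<inter> K"

end

theory Submission
  imports Defs
begin

unbundle no inner_syntax

text \<open>
  Let K be the free spectrahedron and G the graded lift of F. A tuple belongs to the matrix affine
  hull of F iff its compressions to unit vectors lie in the affine hull of F, so G is closed under
  passing to direct summands within K; hence free extreme points of K lying in G are free extreme in G.

  Conversely, let X be free extreme in G and a matrix convex combination of Y in K with coefficients V.
  Compressing Y to the range of V lands in G because F is a face, and extremality in G forces this
  compression to be X up to orthogonal equivalence. It remains to see that Y is a trivial dilation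
  of X. Let b be an off-diagonal column of Y and \<gamma> a relative interior point of F. A null vector of
  the pencil at \<gamma> is a null vector at every point of F, thus gives null vectors of the pencil of
  X, and these are annihilated by b since Y is in K. So b stays in the direction of F, and, again
  by comparing kernels, the dilation of X with small off-diagonal t b and corner \<gamma> lies in K,
  therefore in G. Extremality of X in G splits this dilation orthogonally, and traces give b = 0.
\<close>

text \<open>The obstacle: a dilation \<open>Y\<close> of \<open>X\<close> in the spectrahedron has a
  corner that bears no relation to \<open>F\<close>, so extremality in the lift says nothing about
  \<open>Y\<close> itself. Hence one vector \<open>q\<close> orthogonal to the copy of
  \<open>X\<close> is treated at a time; its corner is thrown away and replaced by \<gamma>, and
  only the column b is kept, shrunk by t. The exchange works because a positive semidefinite Q
  absorbs every small multiple of a symmetric S whose kernel contains that of Q, which turns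
  questions of positivity into questions about null vectors. A relative interior \<gamma> has the
  smallest kernel on \<open>F\<close>, and the face property makes every line along which \<gamma>
  can move both ways a direction of \<open>F\<close>. The range of V is used in place of the whole
  space of \<open>Y\<close> because its dimension is at most the size of \<open>X\<close>, which
  rules out the larger alternative in the definition of an extreme point. A corner of size one is
  chosen because its trace determines it.\<close>

section \<open>Orthonormal systems of semidefinite forms\<close>

text \<open>The form may be degenerate: a residual vector of length zero is orthogonal to everything and is dropped.\<close>

lemma gram_schmidt_form:
  fixes q :: "('a \<Rightarrow> real) \<Rightarrow> ('a \<Rightarrow> real) \<Rightarrow> real" and e :: "nat \<Rightarrow> 'a \<Rightarrow> real"
  assumes lin: "\<And>v x y a b. q v (\<lambda>i. a * x i + b * y i) = a * q v x + b * q v y"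
    and sym: "\<And>u v. q u v = q v u"
    and pos: "\<And>v. 0 \<le> q v v"
  shows "\<exists>k\<le>m. \<exists>t. (\<forall>r<k. \<forall>s<k. q (t r) (t s) = of_bool (r = s)) \<and>
    (\<forall>j<m. \<forall>v. q v (e j) = (\<Sum>r<k. q v (t r) * q (t r) (e j)))"
proof (induction m)
  case 0
  show ?case by (intro exI[of _ 0]) auto
next
  case (Suc m)
  then obtain k t where k: "k \<le> m"
    and orth: "\<And>r s. r < k \<Longrightarrow> s < k \<Longrightarrow> q (t r) (t s) = of_bool (r = s)"
    and res: "\<And>j v. j < m \<Longrightarrow> q v (e j) = (\<Sum>r<k. q v (t r) * q (t r) (e j))"
    by blast
  define w where "w = (\<lambda>i. e m i - (\<Sum>r<k. q (t r) (e m) * t r i))"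
  have lin0: "q v (\<lambda>i. 0) = 0" for v
    using lin[of v 0 "\<lambda>_. 0" 0 "\<lambda>_. 0"] by simp
  have lin_sum: "q v (\<lambda>i. \<Sum>r<l. c r * t r i) = (\<Sum>r<l. c r * q v (t r))" for v c and l :: nat
  proof (induction l)
    case 0
    then show ?case by (simp add: lin0)
  next
    case (Suc l)
    then show ?case
      using lin[of v 1 "\<lambda>i. \<Sum>r<l. c r * t r i" "c l" "t l"] by simp
  qed
  have qw: "q v w = q v (e m) - (\<Sum>r<k. q v (t r) * q (t r) (e m))" for v
    using lin[of v 1 "e m" "-1" "\<lambda>i. \<Sum>r<k. q (t r) (e m) * t r i"] lin_sum[of v "\<lambda>r. q (t r) (e m)" k]
    by (simp add: w_def mult.commute)
  have wt: "q (t s) w = 0" if "s < k" for s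
    using that by (simp add: qw orth of_bool_def if_distrib[of "\<lambda>x. x * _"] cong: if_cong)
  then have tw: "q w (t s) = 0" if "s < k" for s
    using that sym[of w "t s"] by simp
  have we: "q w (e j) = 0" if "j < m" for j
    using res[OF that, of w] tw by simp
  have wm: "q w (e m) = q w w"
    using qw[of w] tw by simp
  show ?case
  proof (cases "q w w = 0")
    case True
    have "q v w = 0" for v
    proof (rule ccontr)
      assume nz: "q v w \<noteq> 0"
      \<comment> \<open>With \<open>q w w = 0\<close> the form at \<open>v + s w\<close> is affine
        in \<open>s\<close>; this \<open>s\<close> gives it the value -1.\<close>
      define s where "s = - (q v v + 1) / (2 * q v w)"
      have "0 \<le> q (\<lambda>i. 1 * v i + s * w i) (\<lambda>i. 1 * v i + s * w i)" by (rule pos)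
      also have "\<dots> = q v v + 2 * s * q v w"
        unfolding lin sym[of "\<lambda>i. 1 * v i + s * w i" v] sym[of "\<lambda>i. 1 * v i + s * w i" w] using True sym[of w v]
        by (simp add: algebra_simps)
      also have "\<dots> = -1"
        using nz by (simp add: s_def field_simps)
      finally show False by simp
    qed
    then have "q v (e m) = (\<Sum>r<k. q v (t r) * q (t r) (e m))" for v
      using qw[of v] by simp
    with res have res': "q v (e j) = (\<Sum>r<k. q v (t r) * q (t r) (e j))" if "j < Suc m" for j v
      using that by (metis less_SucE)
    show ?thesis
      by (intro exI[of _ k] conjI exI[of _ t] allI impI) (use k in simp, fact orth, fact res')
  next
    case False
    define c where "c = sqrt (q w w)"
    have c: "c \<noteq> 0" "c * c = q w w"
      using False pos[of w] by (auto simp: c_def)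
    define t' where "t' = t(k := \<lambda>i. w i / c)"
    have qt': "q v (t' k) = q v w / c" for v
      using lin[of v "1 / c" w 0 w] by (simp add: t'_def)
    have t': "t' r = t r" if "r < k" for r
      using that by (simp add: t'_def)
    have orth': "q (t' r) (t' s) = of_bool (r = s)" if "r < Suc k" "s < Suc k" for r s
    proof -
      consider "r < k" "s < k" | "r < k" "s = k" | "r = k" "s < k" | "r = k" "s = k"
        using \<open>r < Suc k\<close> \<open>s < Suc k\<close> by (auto simp: less_Suc_eq)
      then show ?thesis
      proof cases
        case 4
        have "q (t' k) w = q w (t' k)" by (rule sym)
        then show ?thesis using 4 c False by (simp add: qt')
      qed (use wt orth sym[of "t' k" "t s"] in \<open>auto simp: t' qt'\<close>)
    qed
    have res': "q v (e j) = (\<Sum>r<Suc k. q v (t' r) * q (t' r) (e j))" if "j < Suc m" for j v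
    proof -
      have "q (t' k) (e j) = q w (e j) / c"
        by (metis qt' sym)
      then have last: "q v (t' k) * q (t' k) (e j) = q v w * q w (e j) / q w w"
        by (simp add: qt' flip: c(2))
      show ?thesis
      proof (cases "j < m")
        case True
        then show ?thesis using last by (simp add: t' we res[OF True, of v])
      next
        case False
        then have "j = m" using that by simp
        then show ?thesis using last \<open>q w w \<noteq> 0\<close> by (simp add: t' wm qw[of v])
      qed
    qed
    show ?thesis
      by (intro exI[of _ "Suc k"] conjI exI[of _ t'] allI impI) (use k in simp, fact orth', fact res')
  qed
qed

lemma mult_unit_vec:
  fixes M :: "real mat"
  assumes "M \<in> carrier_mat m n" "i < n"
  shows "M *\<^sub>v unit_vec n i = col M i"
  using assms by (intro eq_vecI) auto

text \<open>Parseval for the form of \<open>Q\<close>, applied to the standard basis: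
  \<open>T * T\<^sup>T\<close> is a generalized inverse of \<open>Q\<close>. It serves where one
  would otherwise diagonalize.\<close>

lemma psd_orthonormal_system:
  fixes Q :: "real mat"
  assumes Q: "Q \<in> carrier_mat n n" "Q\<^sup>T = Q"
    and pos: "\<And>v. v \<in> carrier_vec n \<Longrightarrow> 0 \<le> v \<bullet> (Q *\<^sub>v v)"
  obtains k T where "k \<le> n" "T \<in> carrier_mat n k" "T\<^sup>T * (Q * T) = 1\<^sub>m k" "Q * (T * (T\<^sup>T * Q)) = Q"
proof -
  define q where "q u v = vec n u \<bullet> (Q *\<^sub>v vec n v)" for u v :: "nat \<Rightarrow> real"
  have lin: "q v (\<lambda>i. a * x i + b * y i) = a * q v x + b * q v y" for v x y a b
  proof -
    have *: "vec n (\<lambda>i. a * x i + b * y i) = a \<cdot>\<^sub>v vec n x + b \<cdot>\<^sub>v vec n y"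
      by (intro eq_vecI) auto
    show ?thesis
      unfolding q_def * using Q
      by (subst mult_add_distrib_mat_vec[OF Q(1)], simp, simp,
          subst scalar_prod_add_distrib[where n = n], auto simp: mult_mat_vec[OF Q(1)])
  qed
  have sym: "q u v = q v u" for u v
    unfolding q_def using transpose_vec_mult_scalar[OF Q(1), of "vec n v" "vec n u"] Q
    by (simp add: comm_scalar_prod[where n = n])
  have "\<exists>k\<le>n. \<exists>t. (\<forall>r<k. \<forall>s<k. q (t r) (t s) = of_bool (r = s)) \<and>
    (\<forall>j<n. \<forall>v. q v (\<lambda>i. of_bool (i = j)) = (\<Sum>r<k. q v (t r) * q (t r) (\<lambda>i. of_bool (i = j))))"
    using gram_schmidt_form[of q n "\<lambda>j i. of_bool (i = j)"] lin sym pos by (simp add: q_def)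
  then obtain k t where k: "k \<le> n"
    and orth: "\<And>r s. r < k \<Longrightarrow> s < k \<Longrightarrow> q (t r) (t s) = of_bool (r = s)"
    and res: "\<And>j v. j < n \<Longrightarrow> q v (\<lambda>i. of_bool (i = j)) =
       (\<Sum>r<k. q v (t r) * q (t r) (\<lambda>i. of_bool (i = j)))"
    by blast
  define T where "T = mat n k (\<lambda>(i, r). t r i)"
  have T: "T \<in> carrier_mat n k" by (simp add: T_def)
  have colT: "col T r = vec n (t r)" if "r < k" for r
    using that by (auto simp: T_def)
  have unit: "vec n (\<lambda>i. of_bool (i = j)) = unit_vec n j" for j
    by (auto simp: unit_vec_def)
  have QT: "(Q * T) $$ (i, r) = q (\<lambda>l. of_bool (l = i)) (t r)" if "i < n" "r < k" for i r
    using that T Q by (simp add: q_def colT unit)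
  have TQT: "(T\<^sup>T * (Q * T)) $$ (r, s) = q (t r) (t s)" if "r < k" "s < k" for r s
    using that T Q by (simp add: q_def colT)
  have TQ: "(T\<^sup>T * Q) $$ (r, i) = q (t r) (\<lambda>l. of_bool (l = i))" if "i < n" "r < k" for i r
    using that T Q by (simp add: q_def colT unit mult_unit_vec[OF Q(1)])
  have Qij: "Q $$ (i, j) = q (\<lambda>l. of_bool (l = i)) (\<lambda>l. of_bool (l = j))" if "i < n" "j < n" for i j
    using that Q by (simp add: q_def unit)
  have "Q * (T * (T\<^sup>T * Q)) = Q * T * (T\<^sup>T * Q)"
    using Q T by (intro assoc_mult_mat[symmetric]) auto
  also have "\<dots> = Q"
  proof (rule eq_matI)
    fix i j assume "i < dim_row Q" "j < dim_col Q"
    then have ij: "i < n" "j < n" using Q by auto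
    have "(Q * T * (T\<^sup>T * Q)) $$ (i, j) = (\<Sum>r<k. (Q * T) $$ (i, r) * (T\<^sup>T * Q) $$ (r, j))"
      using ij Q T by (simp add: scalar_prod_def lessThan_atLeast0)
    also have "\<dots> = Q $$ (i, j)"
      using ij by (simp add: QT TQ Qij res[of j "\<lambda>l. of_bool (l = i)"])
    finally show "(Q * T * (T\<^sup>T * Q)) $$ (i, j) = Q $$ (i, j)" .
  qed (use Q T in auto)
  finally have "Q * (T * (T\<^sup>T * Q)) = Q" .
  moreover have "T\<^sup>T * (Q * T) = 1\<^sub>m k"
  proof (rule eq_matI)
    fix r s assume "r < dim_row (1\<^sub>m k :: real mat)" "s < dim_col (1\<^sub>m k :: real mat)"
    then have "r < k" "s < k" by auto
    then show "(T\<^sup>T * (Q * T)) $$ (r, s) = 1\<^sub>m k $$ (r, s)"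
      unfolding TQT[OF \<open>r < k\<close> \<open>s < k\<close>] by (simp add: orth)
  qed (use T in auto)
  ultimately show ?thesis using that k T by blast
qed

section \<open>Scalar products, adjoints and null vectors\<close>

lemma scalar_prod_self_eq_0_iff:
  fixes v :: "real vec"
  assumes "v \<in> carrier_vec n"
  shows "v \<bullet> v = 0 \<longleftrightarrow> v = 0\<^sub>v n"
proof
  assume "v \<bullet> v = 0"
  then have "\<forall>i\<in>{0..<n}. v $ i * v $ i = 0"
    using assms by (subst sum_nonneg_eq_0_iff[symmetric]) (auto simp: scalar_prod_def)
  then show "v = 0\<^sub>v n"
    using assms by (intro eq_vecI) auto
qed (use assms in auto)

lemma scalar_prod_self_nonneg: "0 \<le> v \<bullet> (v :: real vec)"
  by (auto simp: scalar_prod_def intro: sum_nonneg)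

lemma scalar_prod_adjoint:
  fixes V :: "real mat"
  assumes "V \<in> carrier_mat m n" "x \<in> carrier_vec n" "y \<in> carrier_vec m"
  shows "(V *\<^sub>v x) \<bullet> y = x \<bullet> (V\<^sup>T *\<^sub>v y)"
  using transpose_vec_mult_scalar[of "V\<^sup>T" n m y x] assms by simp

text \<open>Comparing matrices as bilinear forms lets adjoints take the place of entry
  computations.\<close>

lemma eq_mat_by_scalar_prod:
  fixes M M' :: "real mat"
  assumes "M \<in> carrier_mat m n" "M' \<in> carrier_mat m n"
    and "\<And>x y. x \<in> carrier_vec m \<Longrightarrow> y \<in> carrier_vec n \<Longrightarrow> x \<bullet> (M *\<^sub>v y) = x \<bullet> (M' *\<^sub>v y)"
  shows "M = M'"
proof (rule eq_matI)
  fix i j assume "i < dim_row M'" "j < dim_col M'"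
  then show "M $$ (i, j) = M' $$ (i, j)"
    using assms(3)[of "unit_vec m i" "unit_vec n j"] assms(1,2) by (simp add: mult_unit_vec)
qed (use assms in auto)

lemma eq_mat_by_vec:
  fixes M M' :: "real mat"
  assumes "M \<in> carrier_mat m n" "M' \<in> carrier_mat m n"
    and "\<And>y. y \<in> carrier_vec n \<Longrightarrow> M *\<^sub>v y = M' *\<^sub>v y"
  shows "M = M'"
  using assms by (intro eq_mat_by_scalar_prod[of M m n]) auto

lemma symmetric_scalar_prod:
  fixes M :: "real mat"
  assumes "M \<in> carrier_mat n n" "M\<^sup>T = M" "x \<in> carrier_vec n" "y \<in> carrier_vec n"
  shows "x \<bullet> (M *\<^sub>v y) = y \<bullet> (M *\<^sub>v x)"
  using scalar_prod_adjoint[of M n n x y] assms by (metis comm_scalar_prod mult_mat_vec_carrier)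

lemma psd_iff:
  assumes "M \<in> carrier_mat n n"
  shows "psd M \<longleftrightarrow> M\<^sup>T = M \<and> (\<forall>v\<in>carrier_vec n. 0 \<le> v \<bullet> (M *\<^sub>v v))"
  using assms by (auto simp: psd_def)

lemma quadratic_zero_cross_zero:
  fixes a b :: real
  assumes "\<And>s. 0 \<le> a + s * b"
  shows "b = 0"
proof (rule ccontr)
  assume "b \<noteq> 0"
  then show False
    using assms[of "- (a + 1) / b"] by (simp add: field_simps)
qed

text \<open>With \<open>w = M v\<close> the form at \<open>w + s v\<close> is affine in
  \<open>s\<close> with slope \<open>2 (w \<bullet> w)\<close>; being nonnegative for all
  \<open>s\<close>, it has slope zero.\<close>

lemma psd_null_vector:
  assumes M: "M \<in> carrier_mat n n" "psd M" and v: "v \<in> carrier_vec n" "v \<bullet> (M *\<^sub>v v) = 0"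
  shows "M *\<^sub>v v = 0\<^sub>v n"
proof -
  let ?w = "M *\<^sub>v v"
  have w: "?w \<in> carrier_vec n" using M v by simp
  have sym: "M\<^sup>T = M" and pos: "\<And>v. v \<in> carrier_vec n \<Longrightarrow> 0 \<le> v \<bullet> (M *\<^sub>v v)"
    using M by (auto simp: psd_iff)
  have wv: "v \<bullet> (M *\<^sub>v ?w) = ?w \<bullet> ?w"
    by (rule symmetric_scalar_prod[OF M(1) sym v(1) w])
  have "0 \<le> ?w \<bullet> (M *\<^sub>v ?w) + s * (2 * (?w \<bullet> ?w))" for s
  proof -
    have "0 \<le> (?w + s \<cdot>\<^sub>v v) \<bullet> (M *\<^sub>v (?w + s \<cdot>\<^sub>v v))"
      using w v by (intro pos) simp
    also have "\<dots> = ?w \<bullet> (M *\<^sub>v ?w) + s * (2 * (?w \<bullet> ?w))"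
      using M v w
      by (simp add: mult_add_distrib_mat_vec[OF M(1)] mult_mat_vec[OF M(1)] wv
          scalar_prod_add_distrib[where n = n] add_scalar_prod_distrib[where n = n])
    finally show ?thesis .
  qed
  then have "2 * (?w \<bullet> ?w) = 0"
    by (rule quadratic_zero_cross_zero)
  then show ?thesis
    using scalar_prod_self_eq_0_iff[OF w] by simp
qed

section \<open>Orthonormal bases of ranges and complements\<close>

lemma mult_mat_vec4:
  fixes A B C D :: "'a::comm_semiring_0 mat"
  assumes A: "A \<in> carrier_mat n1 n2" and B: "B \<in> carrier_mat n2 n3" and C: "C \<in> carrier_mat n3 n4"
    and D: "D \<in> carrier_mat n4 n5" and v: "v \<in> carrier_vec n5"
  shows "(A * (B * (C * D))) *\<^sub>v v = A *\<^sub>v (B *\<^sub>v (C *\<^sub>v (D *\<^sub>v v)))"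
proof -
  note CD = mult_carrier_mat[OF C D]
  note BCD = mult_carrier_mat[OF B CD]
  show ?thesis
    unfolding assoc_mult_mat_vec[OF A BCD v] assoc_mult_mat_vec[OF B CD v] assoc_mult_mat_vec[OF C D v] ..
qed

lemma minus_vec_eq_0_iff:
  fixes v w :: "'a::group_add vec"
  assumes "v \<in> carrier_vec n" "w \<in> carrier_vec n"
  shows "v - w = 0\<^sub>v n \<longleftrightarrow> v = w"
  using assms by (auto simp: vec_eq_iff)

text \<open>An orthonormal system \<open>S\<close> for the Gram matrix of \<open>V\<close> is
  carried by \<open>V\<close> to orthonormal columns spanning its range, also when \<open>V\<close>
  is rank deficient. The factorization \<open>P = V * S\<close> is kept because the face argument
  evaluates summands at vectors in the range of \<open>V\<close>.\<close>

lemma isometry_range: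
  fixes V :: "real mat"
  assumes V: "V \<in> carrier_mat N n"
  obtains k P S where "k \<le> n" "P \<in> carrier_mat N k" "S \<in> carrier_mat n k" "P = V * S"
    "P\<^sup>T * P = 1\<^sub>m k" "P * (P\<^sup>T * V) = V"
proof -
  let ?Q = "V\<^sup>T * V"
  have Q: "?Q \<in> carrier_mat n n" "?Q\<^sup>T = ?Q" using V by (auto simp: transpose_mult[of _ n N])
  have Qv: "x \<bullet> (?Q *\<^sub>v y) = (V *\<^sub>v x) \<bullet> (V *\<^sub>v y)"
    if "x \<in> carrier_vec n" "y \<in> carrier_vec n" for x y
    using that V by (simp add: scalar_prod_adjoint[OF V])
  obtain k S where k: "k \<le> n" and S: "S \<in> carrier_mat n k"
    and orth: "S\<^sup>T * (?Q * S) = 1\<^sub>m k" and res: "?Q * (S * (S\<^sup>T * ?Q)) = ?Q"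
    using psd_orthonormal_system[OF Q] Qv scalar_prod_self_nonneg by metis
  define P where "P = V * S"
  have P: "P \<in> carrier_mat N k" and ST: "S\<^sup>T \<in> carrier_mat k n" using V S by (simp_all add: P_def)
  have PT: "P\<^sup>T = S\<^sup>T * V\<^sup>T" unfolding P_def using V S by (simp add: transpose_mult)
  have PP: "P\<^sup>T * P = 1\<^sub>m k"
  proof -
    have "P\<^sup>T * P = S\<^sup>T * (?Q * S)"
      unfolding PT unfolding P_def using V S
      by (simp add: assoc_mult_mat[of _ k n _ N _ k] assoc_mult_mat[of _ n N _ n _ k])
    then show ?thesis using orth by simp
  qed
  have "P * (P\<^sup>T * V) *\<^sub>v x = V *\<^sub>v x" if x: "x \<in> carrier_vec n" for x
  proof -
    let ?y = "V *\<^sub>v x" and ?a = "P\<^sup>T *\<^sub>v (V *\<^sub>v x)"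
    have y: "?y \<in> carrier_vec N" and a: "?a \<in> carrier_vec k" using V P x by auto
    have z: "P *\<^sub>v ?a \<in> carrier_vec N" using P a by simp
    \<comment> \<open>The projection of \<open>y = V x\<close> by \<open>P * P\<^sup>T\<close> has
      the length of \<open>y\<close> and the scalar product \<open>y \<bullet> y\<close> with
      \<open>y\<close>, so the difference of the two has length zero.\<close>
    have aa: "?a \<bullet> ?a = ?y \<bullet> ?y"
    proof -
      have "?a = S\<^sup>T *\<^sub>v (?Q *\<^sub>v x)" using V S x by (simp add: PT)
      then have "?a \<bullet> ?a = (S\<^sup>T *\<^sub>v (?Q *\<^sub>v x)) \<bullet> (S\<^sup>T *\<^sub>v (?Q *\<^sub>v x))" by simp
      also have "\<dots> = (?Q *\<^sub>v x) \<bullet> (S *\<^sub>v (S\<^sup>T *\<^sub>v (?Q *\<^sub>v x)))"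
        using scalar_prod_adjoint[of "S\<^sup>T" k n "?Q *\<^sub>v x"] S Q x by simp
      also have "\<dots> = x \<bullet> (?Q *\<^sub>v (S *\<^sub>v (S\<^sup>T *\<^sub>v (?Q *\<^sub>v x))))"
        using scalar_prod_adjoint[OF Q(1) x] S Q x by simp
      also have "?Q *\<^sub>v (S *\<^sub>v (S\<^sup>T *\<^sub>v (?Q *\<^sub>v x))) = (?Q * (S * (S\<^sup>T * ?Q))) *\<^sub>v x"
        by (rule mult_mat_vec4[symmetric, OF Q(1) S ST Q(1) x])
      also have "x \<bullet> \<dots> = ?y \<bullet> ?y" using res Qv x by simp
      finally show ?thesis .
    qed
    have yz: "?y \<bullet> (P *\<^sub>v ?a) = ?a \<bullet> ?a"
      using scalar_prod_adjoint[OF P a y] P a y by (metis comm_scalar_prod mult_mat_vec_carrier)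
    have zz: "(P *\<^sub>v ?a) \<bullet> (P *\<^sub>v ?a) = ?a \<bullet> ?a"
    proof -
      have "P\<^sup>T *\<^sub>v (P *\<^sub>v ?a) = ?a"
        using PP P a by (metis assoc_mult_mat_vec one_mult_mat_vec transpose_carrier_mat)
      then show ?thesis using scalar_prod_adjoint[OF P a z] by simp
    qed
    have "(P *\<^sub>v ?a - ?y) \<bullet> (P *\<^sub>v ?a - ?y) = 0"
      using y z aa yz zz
      by (simp add: minus_scalar_prod_distrib[where n = N] scalar_prod_minus_distrib[where n = N]
          comm_scalar_prod[OF z y])
    then have "P *\<^sub>v ?a - ?y = 0\<^sub>v N"
      using scalar_prod_self_eq_0_iff y z by (metis minus_carrier_vec)
    then have "P *\<^sub>v ?a = ?y"
      by (simp add: minus_vec_eq_0_iff[OF z y])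
    then show ?thesis
      using P V x by (simp add: assoc_mult_mat_vec[of P N k _ n] assoc_mult_mat_vec[of "P\<^sup>T" k N])
  qed
  then have "P * (P\<^sup>T * V) = V"
    using P V by (intro eq_mat_by_vec[of _ N n]) auto
  with that k P S PP P_def show ?thesis by blast
qed

definition mat_trace :: "real mat \<Rightarrow> real" where
  "mat_trace M = (\<Sum>i<dim_row M. M $$ (i, i))"

lemma mat_trace_mult_commute:
  assumes "M \<in> carrier_mat m n" "M' \<in> carrier_mat n m"
  shows "mat_trace (M * M') = mat_trace (M' * M)"
proof -
  have "mat_trace (M * M') = (\<Sum>i<m. \<Sum>j<n. M $$ (i, j) * M' $$ (j, i))"
    using assms by (auto simp: mat_trace_def scalar_prod_def lessThan_atLeast0 intro!: sum.cong)
  also have "\<dots> = (\<Sum>j<n. \<Sum>i<m. M $$ (i, j) * M' $$ (j, i))"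
    by (rule sum.swap)
  also have "\<dots> = mat_trace (M' * M)"
    using assms by (auto simp: mat_trace_def scalar_prod_def lessThan_atLeast0 mult.commute intro!: sum.cong)
  finally show ?thesis .
qed

text \<open>\<open>Q = 1 - P P\<^sup>T\<close> is the projection onto the orthogonal complement. An
  orthonormal system \<open>T\<close> for its form gives \<open>R = Q T\<close> with
  \<open>R R\<^sup>T = Q\<close>.\<close>

lemma isometry_complement:
  fixes P :: "real mat"
  assumes P: "P \<in> carrier_mat N n" and PP: "P\<^sup>T * P = 1\<^sub>m n"
  obtains k R where "N = n + k" "R \<in> carrier_mat N k" "R\<^sup>T * R = 1\<^sub>m k" "P\<^sup>T * R = 0\<^sub>m n k"
    "P * P\<^sup>T + R * R\<^sup>T = 1\<^sub>m N"
proof -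
  define Q where "Q = 1\<^sub>m N - P * P\<^sup>T"
  have Q: "Q \<in> carrier_mat N N" using P unfolding Q_def by (intro minus_carrier_mat) auto
  have QT: "Q\<^sup>T = Q" using P by (simp add: Q_def transpose_minus[of _ N N] transpose_mult[of _ N n])
  have PQ: "P\<^sup>T * Q = 0\<^sub>m n N"
  proof -
    have "P\<^sup>T * (P * P\<^sup>T) = P\<^sup>T * P * P\<^sup>T" using P by (simp add: assoc_mult_mat[of _ n N _ n _ N])
    also have "\<dots> = P\<^sup>T" using P PP by simp
    finally show ?thesis
      using P unfolding Q_def by (subst mult_minus_distrib_mat[of _ n N _ N]) auto
  qed
  have QQ: "Q * Q = Q"
  proof -
    have "P * P\<^sup>T * Q = P * (P\<^sup>T * Q)" using P Q by (simp add: assoc_mult_mat[of _ N n _ N _ N])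
    also have "\<dots> = 0\<^sub>m N N" using PQ P by simp
    finally have "(1\<^sub>m N - P * P\<^sup>T) * Q = Q"
      using P Q by (subst minus_mult_distrib_mat[of _ N N _ _ N]) auto
    then show ?thesis unfolding Q_def .
  qed
  have pos: "0 \<le> v \<bullet> (Q *\<^sub>v v)" if v: "v \<in> carrier_vec N" for v
  proof -
    have "v \<bullet> (Q *\<^sub>v v) = v \<bullet> (Q *\<^sub>v (Q *\<^sub>v v))"
      using QQ Q v by (metis assoc_mult_mat_vec)
    also have "\<dots> = (Q *\<^sub>v v) \<bullet> (Q *\<^sub>v v)"
      using scalar_prod_adjoint[OF Q v] Q v QT by simp
    finally show ?thesis by (simp add: scalar_prod_self_nonneg)
  qed
  obtain k T where T: "T \<in> carrier_mat N k"
    and orth: "T\<^sup>T * (Q * T) = 1\<^sub>m k" and res: "Q * (T * (T\<^sup>T * Q)) = Q"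
    using psd_orthonormal_system[OF Q QT pos] by metis
  define R where "R = Q * T"
  have R: "R \<in> carrier_mat N k" using Q T by (simp add: R_def)
  have RT: "R\<^sup>T = T\<^sup>T * Q" using Q T QT by (simp add: R_def transpose_mult[of _ N N])
  have RR: "R\<^sup>T * R = 1\<^sub>m k"
  proof -
    have "R\<^sup>T * R = T\<^sup>T * (Q * (Q * T))"
      unfolding RT unfolding R_def using Q T by (simp add: assoc_mult_mat[of _ k N _ N _ k])
    also have "Q * (Q * T) = Q * Q * T" using Q T by (simp add: assoc_mult_mat[of _ N N _ N _ k])
    finally show ?thesis using QQ orth by simp
  qed
  have PR: "P\<^sup>T * R = 0\<^sub>m n k"
  proof -
    have "P\<^sup>T * R = P\<^sup>T * Q * T"
      unfolding R_def using P Q T by (simp add: assoc_mult_mat[of _ n N _ N _ k])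
    then show ?thesis using PQ T by simp
  qed
  have "R * R\<^sup>T = Q"
    unfolding RT unfolding R_def using res Q T by (simp add: assoc_mult_mat[of _ N N _ k _ N])
  then have sum: "P * P\<^sup>T + R * R\<^sup>T = 1\<^sub>m N"
    using P unfolding Q_def by (intro eq_matI) auto
  have tr1: "mat_trace (1\<^sub>m l) = real l" for l
    by (simp add: mat_trace_def)
  \<comment> \<open>Traces count dimensions: \<open>P P\<^sup>T\<close> has the trace of
    \<open>P\<^sup>T P\<close>, which is \<open>n\<close>.\<close>
  have "real N = mat_trace (P * P\<^sup>T + R * R\<^sup>T)"
    by (simp add: sum tr1)
  also have "\<dots> = mat_trace (P * P\<^sup>T) + mat_trace (R * R\<^sup>T)"
    using P R by (simp add: mat_trace_def sum.distrib)
  also have "\<dots> = mat_trace (P\<^sup>T * P) + mat_trace (R\<^sup>T * R)"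
    using P R by (simp add: mat_trace_mult_commute[of P N n] mat_trace_mult_commute[of R N k])
  also have "\<dots> = real (n + k)"
    by (simp add: PP RR tr1)
  finally have "N = n + k" by simp
  with that R RR PR sum show ?thesis by blast
qed

section \<open>Perturbation of semidefinite matrices\<close>

lemma scalar_prod_mat_bound:
  fixes M :: "real mat"
  assumes M: "M \<in> carrier_mat k k" and a: "a \<in> carrier_vec k"
  shows "\<bar>a \<bullet> (M *\<^sub>v a)\<bar> \<le> (\<Sum>i<k. \<Sum>j<k. \<bar>M $$ (i, j)\<bar>) * (a \<bullet> a)"
proof -
  have sq: "a $ i * a $ i \<le> a \<bullet> a" if "i < k" for i
    using that a unfolding scalar_prod_def
    by (intro member_le_sum[of i "{0..<dim_vec a}" "\<lambda>i. a $ i * a $ i"]) auto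
  \<comment> \<open>Since every product of two coordinates is at most \<open>a \<bullet> a\<close>,
    the sum of the absolute entries does the work of an operator norm.\<close>
  have ij: "\<bar>a $ i * a $ j\<bar> \<le> a \<bullet> a" if "i < k" "j < k" for i j
    using sq[OF that(1)] sq[OF that(2)] sum_squares_bound[of "\<bar>a $ i\<bar>" "\<bar>a $ j\<bar>"]
    by (simp add: abs_mult power2_eq_square)
  have "\<bar>a \<bullet> (M *\<^sub>v a)\<bar> = \<bar>\<Sum>i<k. \<Sum>j<k. M $$ (i, j) * (a $ i * a $ j)\<bar>"
    using M a by (simp add: scalar_prod_def lessThan_atLeast0 sum_distrib_left ac_simps)
  also have "\<dots> \<le> (\<Sum>i<k. \<Sum>j<k. \<bar>M $$ (i, j) * (a $ i * a $ j)\<bar>)"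
    by (rule order_trans[OF sum_abs sum_mono[OF sum_abs]])
  also have "\<dots> \<le> (\<Sum>i<k. \<Sum>j<k. \<bar>M $$ (i, j)\<bar> * (a \<bullet> a))"
    using ij by (intro sum_mono) (auto simp: abs_mult[of "M $$ _"] intro!: mult_left_mono)
  finally show ?thesis by (simp add: sum_distrib_right)
qed

text \<open>
  With T the orthonormal system of Q, the kernel condition turns S into Q T (T^t S T) T^t Q, so S is
  bounded by a multiple of Q T T^t Q = Q.
\<close>

lemma psd_perturbation:
  fixes Q S :: "real mat"
  assumes Q: "Q \<in> carrier_mat n n" "psd Q" and S: "S \<in> carrier_mat n n" "S\<^sup>T = S"
    and ker: "\<And>v. v \<in> carrier_vec n \<Longrightarrow> Q *\<^sub>v v = 0\<^sub>v n \<Longrightarrow> S *\<^sub>v v = 0\<^sub>v n"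
  obtains \<epsilon> where "\<epsilon> > 0"
    "\<And>t v. \<bar>t\<bar> \<le> \<epsilon> \<Longrightarrow> v \<in> carrier_vec n \<Longrightarrow> 0 \<le> v \<bullet> (Q *\<^sub>v v) + t * (v \<bullet> (S *\<^sub>v v))"
proof -
  have QT: "Q\<^sup>T = Q" and pos: "\<And>v. v \<in> carrier_vec n \<Longrightarrow> 0 \<le> v \<bullet> (Q *\<^sub>v v)"
    using Q by (auto simp: psd_iff)
  obtain k T where T: "T \<in> carrier_mat n k"
    and res: "Q * (T * (T\<^sup>T * Q)) = Q"
    using psd_orthonormal_system[OF Q(1) QT pos] by metis
  define M where "M = T\<^sup>T * (S * T)"
  have M: "M \<in> carrier_mat k k" using T S by (simp add: M_def)
  define c where "c = (\<Sum>i<k. \<Sum>j<k. \<bar>M $$ (i, j)\<bar>)"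
  have c: "0 \<le> c" by (auto simp: c_def intro!: sum_nonneg)
  have bound: "\<bar>v \<bullet> (S *\<^sub>v v)\<bar> \<le> c * (v \<bullet> (Q *\<^sub>v v))" if v: "v \<in> carrier_vec n" for v
  proof -
    define a where "a = T\<^sup>T *\<^sub>v (Q *\<^sub>v v)"
    have Qv: "Q *\<^sub>v v \<in> carrier_vec n" and TT: "T\<^sup>T \<in> carrier_mat k n" using Q(1) T v by simp_all
    then have a: "a \<in> carrier_vec k" by (simp add: a_def)
    have Ta: "T *\<^sub>v a \<in> carrier_vec n" using T a by simp
    have QTa: "Q *\<^sub>v (T *\<^sub>v a) = Q *\<^sub>v v"
    proof -
      have "Q *\<^sub>v (T *\<^sub>v a) = (Q * (T * (T\<^sup>T * Q))) *\<^sub>v v"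
        unfolding a_def by (rule mult_mat_vec4[symmetric, OF Q(1) T TT Q(1) v])
      then show ?thesis using res by simp
    qed
    have "Q *\<^sub>v (v - T *\<^sub>v a) = 0\<^sub>v n"
      using QTa Q(1) v Ta by (subst mult_minus_distrib_mat_vec[of _ n n]) auto
    then have "S *\<^sub>v (v - T *\<^sub>v a) = 0\<^sub>v n"
      using v Ta by (intro ker) auto
    then have "S *\<^sub>v v - S *\<^sub>v (T *\<^sub>v a) = 0\<^sub>v n"
      using S v Ta by (subst (asm) mult_minus_distrib_mat_vec[of _ n n]) auto
    then have STa: "S *\<^sub>v v = S *\<^sub>v (T *\<^sub>v a)"
      using S v Ta by (subst (asm) minus_vec_eq_0_iff) auto
    have "v \<bullet> (S *\<^sub>v v) = v \<bullet> (S *\<^sub>v (T *\<^sub>v a))" by (simp add: STa)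
    also have "\<dots> = (T *\<^sub>v a) \<bullet> (S *\<^sub>v (T *\<^sub>v a))"
      using symmetric_scalar_prod[OF S v Ta] STa by simp
    also have "\<dots> = a \<bullet> (M *\<^sub>v a)"
      unfolding M_def using scalar_prod_adjoint[OF T a] S T a by (simp add: assoc_mult_mat_vec[of _ k n _ k])
    finally have vSv: "v \<bullet> (S *\<^sub>v v) = a \<bullet> (M *\<^sub>v a)" .
    have "a \<bullet> a = (Q *\<^sub>v v) \<bullet> (T *\<^sub>v a)"
      using scalar_prod_adjoint[of "T\<^sup>T" k n "Q *\<^sub>v v" a] T Q(1) v a by (simp add: a_def)
    also have "\<dots> = v \<bullet> (Q *\<^sub>v v)"
      using scalar_prod_adjoint[OF Q(1) v Ta] QTa QT by simp
    finally show ?thesis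
      using scalar_prod_mat_bound[OF M a] vSv by (simp add: c_def)
  qed
  \<comment> \<open>Adding 1 keeps the bound meaningful for \<open>c = 0\<close>, and
    \<open>c / (c + 1)\<close> stays below 1.\<close>
  show ?thesis
  proof (rule that[of "1 / (c + 1)"])
    fix t :: real and v :: "real vec"
    assume t: "\<bar>t\<bar> \<le> 1 / (c + 1)" and v: "v \<in> carrier_vec n"
    have "\<bar>t * (v \<bullet> (S *\<^sub>v v))\<bar> \<le> 1 / (c + 1) * (c * (v \<bullet> (Q *\<^sub>v v)))"
      unfolding abs_mult using t bound[OF v] c by (intro mult_mono) auto
    also have "\<dots> = c / (c + 1) * (v \<bullet> (Q *\<^sub>v v))" by simp
    also have "\<dots> \<le> 1 * (v \<bullet> (Q *\<^sub>v v))"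
      using c pos[OF v] by (intro mult_right_mono) (auto simp: field_simps)
    finally show "0 \<le> v \<bullet> (Q *\<^sub>v v) + t * (v \<bullet> (S *\<^sub>v v))" by simp
  qed (use c in auto)
qed

section \<open>Linear pencils as quadratic forms\<close>

lemma sum_lessThan_mult:
  fixes f :: "nat \<Rightarrow> 'a::comm_monoid_add"
  shows "(\<Sum>r<d * n. f r) = (\<Sum>a<d. \<Sum>p<n. f (a * n + p))"
proof -
  have "sum f {a * n..<a * n + n} = (\<Sum>p<n. f (a * n + p))" for a
    using sum.shift_bounds_nat_ivl[of f 0 "a * n" n] by (simp add: lessThan_atLeast0 add.commute)
  then show ?thesis
    using sum.nat_group[of f n d] by simp
qed

lemma SM_level_carrier: "X \<in> SM_level n \<Longrightarrow> X i \<in> carrier_mat n n"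
  by (simp add: SM_level_def)

lemma SM_level_sym: "X \<in> SM_level n \<Longrightarrow> (X i)\<^sup>T = X i"
  by (simp add: SM_level_def)

lemma SM_level_unique: "X \<in> SM_level n \<Longrightarrow> X \<in> SM_level m \<Longrightarrow> n = m"
  by (metis SM_level_carrier carrier_matD(1))

text \<open>
  A vector of the Kronecker product of R^d and R^n is handled as a family w of vectors of length n,
  with w a for a < d; its coordinate at a n + p is the p-th entry of w a.
\<close>

definition flat :: "nat \<Rightarrow> nat \<Rightarrow> (nat \<Rightarrow> real vec) \<Rightarrow> real vec" where
  "flat d n w = vec (d * n) (\<lambda>r. w (r div n) $ (r mod n))"

lemma flat_carrier [simp]: "flat d n w \<in> carrier_vec (d * n)"
  by (simp add: flat_def)

lemma flat_surj:
  assumes "v \<in> carrier_vec (d * n)"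
  obtains w where "\<And>a. w a \<in> carrier_vec n" "flat d n w = v"
proof (rule that[of "\<lambda>a. vec n (\<lambda>p. v $ (a * n + p))"])
  show "flat d n (\<lambda>a. vec n (\<lambda>p. v $ (a * n + p))) = v"
  proof (rule eq_vecI)
    fix r assume "r < dim_vec v"
    then have r: "r < d * n" using assms by simp
    then have "r mod n < n" by (cases "n = 0") auto
    then show "flat d n (\<lambda>a. vec n (\<lambda>p. v $ (a * n + p))) $ r = v $ r"
      using r by (simp add: flat_def)
  qed (use assms in \<open>simp add: flat_def\<close>)
qed simp

lemma flat_index:
  assumes "a < d" "p < n"
  shows "flat d n w $ (a * n + p) = w a $ p"
proof -
  have "a * n + p < Suc a * n" using assms by simp
  also have "\<dots> \<le> d * n" using assms by (intro mult_le_mono1) simp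
  finally show ?thesis using assms by (simp add: flat_def)
qed

lemma flat_scalar_prod:
  assumes "\<And>a. w a \<in> carrier_vec n" "\<And>a. w' a \<in> carrier_vec n"
  shows "flat d n w \<bullet> flat d n w' = (\<Sum>a<d. w a \<bullet> w' a)"
proof -
  have "flat d n w \<bullet> flat d n w' = (\<Sum>r<d * n. flat d n w $ r * flat d n w' $ r)"
    by (simp add: scalar_prod_def flat_def lessThan_atLeast0)
  also have "\<dots> = (\<Sum>a<d. \<Sum>p<n. w a $ p * w' a $ p)"
    unfolding sum_lessThan_mult by (intro sum.cong refl) (simp add: flat_index)
  also have "\<dots> = (\<Sum>a<d. w a \<bullet> w' a)"
    by (simp add: scalar_prod_def lessThan_atLeast0 carrier_vecD[OF assms(2)])
  finally show ?thesis .
qed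

text \<open>The bilinear form of the sum of the tensors of \<open>A i\<close> and
  \<open>B i\<close>, on families. The size of \<open>B\<close> does not occur, so one formula
  serves all levels and passes through compressions and direct sums without index
  arithmetic.\<close>

definition pencil_lin :: "nat \<Rightarrow> ('h::finite \<Rightarrow> real mat) \<Rightarrow> ('h \<Rightarrow> real mat) \<Rightarrow>
    (nat \<Rightarrow> real vec) \<Rightarrow> (nat \<Rightarrow> real vec) \<Rightarrow> real" where
  "pencil_lin d A B w w' = (\<Sum>i\<in>UNIV. \<Sum>a<d. \<Sum>b<d. A i $$ (a, b) * (w a \<bullet> (B i *\<^sub>v w' b)))"

definition pencil_form :: "nat \<Rightarrow> ('h::finite \<Rightarrow> real mat) \<Rightarrow> ('h \<Rightarrow> real mat) \<Rightarrow>
    (nat \<Rightarrow> real vec) \<Rightarrow> (nat \<Rightarrow> real vec) \<Rightarrow> real" where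
  "pencil_form d A X w w' = (\<Sum>a<d. w a \<bullet> w' a) - pencil_lin d A X w w'"

text \<open>The homogeneous part of the pencil, separated because a perturbation of a tuple enters
  only through it.\<close>

definition kronecker_sum :: "nat \<Rightarrow> ('h::finite \<Rightarrow> real mat) \<Rightarrow> nat \<Rightarrow> ('h \<Rightarrow> real mat) \<Rightarrow> real mat" where
  "kronecker_sum d A n B = mat_sum (d * n) (\<lambda>i. kronecker (A i) (B i)) UNIV"

lemma kronecker_sum_carrier: "kronecker_sum d A n B \<in> carrier_mat (d * n) (d * n)"
  by (simp add: kronecker_sum_def mat_sum_def)

lemma mult_add_less: "a < d \<Longrightarrow> p < n \<Longrightarrow> a * n + p < d * (n::nat)"
  by (metis add_less_cancel_left less_le_trans mult.commute mult_Suc mult_le_mono1 Suc_leI add.commute)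

lemma kronecker_sum_index:
  assumes A: "A \<in> SM_level d" and B: "B \<in> SM_level n" and "a < d" "b < d" "p < n" "q < n"
  shows "kronecker_sum d A n B $$ (a * n + p, b * n + q) = (\<Sum>i\<in>UNIV. A i $$ (a, b) * B i $$ (p, q))"
proof -
  have "dim_row (A i) = d" "dim_col (A i) = d" "dim_row (B i) = n" "dim_col (B i) = n" for i
    using SM_level_carrier[OF A, of i] SM_level_carrier[OF B, of i] by auto
  then show ?thesis
    using assms(3-) by (simp add: kronecker_sum_def mat_sum_def kronecker_def mult_add_less)
qed

lemma kronecker_sum_sym:
  assumes A: "A \<in> SM_level d" and B: "B \<in> SM_level n"
  shows "(kronecker_sum d A n B)\<^sup>T = kronecker_sum d A n B"
proof (rule eq_matI)
  fix r s assume "r < dim_row (kronecker_sum d A n B)" "s < dim_col (kronecker_sum d A n B)"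
  then have rs: "r < d * n" "s < d * n" using kronecker_sum_carrier[of d A n B] by auto
  then have n: "0 < n" by (cases n) auto
  have mods: "r mod n < n" "s mod n < n" using n by auto
  have divs: "r div n < d" "s div n < d" using rs n by (simp_all add: less_mult_imp_div_less)
  have "A i $$ (s div n, r div n) = A i $$ (r div n, s div n)"
      "B i $$ (s mod n, r mod n) = B i $$ (r mod n, s mod n)" for i
    using SM_level_carrier[OF A, of i] SM_level_carrier[OF B, of i] mods divs
      arg_cong[OF SM_level_sym[OF A, of i], of "\<lambda>M. M $$ (r div n, s div n)"]
      arg_cong[OF SM_level_sym[OF B, of i], of "\<lambda>M. M $$ (r mod n, s mod n)"] by auto
  then have "kronecker_sum d A n B $$ (s, r) = kronecker_sum d A n B $$ (r, s)"
    using kronecker_sum_index[OF A B divs(1) divs(2) mods] kronecker_sum_index[OF A B divs(2) divs(1) mods(2) mods(1)]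
    by simp
  then show "(kronecker_sum d A n B)\<^sup>T $$ (r, s) = kronecker_sum d A n B $$ (r, s)"
    using rs kronecker_sum_carrier[of d A n B] by simp
qed (use kronecker_sum_carrier[of d A n B] in auto)

lemma kronecker_sum_form:
  assumes A: "A \<in> SM_level d" and B: "B \<in> SM_level n"
    and w: "\<And>a. w a \<in> carrier_vec n" and w': "\<And>a. w' a \<in> carrier_vec n"
  shows "flat d n w \<bullet> (kronecker_sum d A n B *\<^sub>v flat d n w') = pencil_lin d A B w w'"
proof -
  let ?K = "kronecker_sum d A n B"
  have Bi: "w a \<bullet> (B i *\<^sub>v w' b) = (\<Sum>p<n. \<Sum>q<n. w a $ p * (B i $$ (p, q) * w' b $ q))" for a b i
    using SM_level_carrier[OF B, of i] w[of a] w'[of b]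
    by (simp add: scalar_prod_def lessThan_atLeast0 sum_distrib_left)
  have "flat d n w \<bullet> (?K *\<^sub>v flat d n w') =
      (\<Sum>r<d * n. \<Sum>s<d * n. flat d n w $ r * (?K $$ (r, s) * flat d n w' $ s))"
    using kronecker_sum_carrier[of d A n B]
    by (simp add: scalar_prod_def lessThan_atLeast0 sum_distrib_left flat_def)
  also have "\<dots> = (\<Sum>a<d. \<Sum>p<n. \<Sum>b<d. \<Sum>q<n.
      w a $ p * ((\<Sum>i\<in>UNIV. A i $$ (a, b) * B i $$ (p, q)) * w' b $ q))"
    unfolding sum_lessThan_mult
    by (intro sum.cong refl) (simp add: flat_index kronecker_sum_index[OF A B])
  also have "\<dots> = (\<Sum>a<d. \<Sum>p<n. \<Sum>b<d. \<Sum>q<n. \<Sum>i\<in>UNIV.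
      A i $$ (a, b) * (w a $ p * (B i $$ (p, q) * w' b $ q)))"
    by (simp add: sum_distrib_left sum_distrib_right ac_simps)
  \<comment> \<open>The swaps bring the sums over the coordinates \<open>p\<close> and
    \<open>q\<close> innermost, where they form a scalar product.\<close>
  also have "\<dots> = (\<Sum>a<d. \<Sum>b<d. \<Sum>p<n. \<Sum>q<n. \<Sum>i\<in>UNIV.
      A i $$ (a, b) * (w a $ p * (B i $$ (p, q) * w' b $ q)))"
    by (rule sum.cong[OF refl sum.swap])
  also have "\<dots> = (\<Sum>a<d. \<Sum>b<d. \<Sum>p<n. \<Sum>i\<in>UNIV. \<Sum>q<n.
      A i $$ (a, b) * (w a $ p * (B i $$ (p, q) * w' b $ q)))"
    by (intro sum.cong refl sum.swap)
  also have "\<dots> = (\<Sum>a<d. \<Sum>b<d. \<Sum>i\<in>UNIV. \<Sum>p<n. \<Sum>q<n.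
      A i $$ (a, b) * (w a $ p * (B i $$ (p, q) * w' b $ q)))"
    by (intro sum.cong refl sum.swap)
  also have "\<dots> = (\<Sum>a<d. \<Sum>b<d. \<Sum>i\<in>UNIV. A i $$ (a, b) * (w a \<bullet> (B i *\<^sub>v w' b)))"
    by (simp add: Bi sum_distrib_left)
  also have "\<dots> = (\<Sum>a<d. \<Sum>i\<in>UNIV. \<Sum>b<d. A i $$ (a, b) * (w a \<bullet> (B i *\<^sub>v w' b)))"
    by (intro sum.cong refl sum.swap)
  also have "\<dots> = pencil_lin d A B w w'"
    unfolding pencil_lin_def by (rule sum.swap)
  finally show ?thesis .
qed

lemma pencil_carrier: "pencil d A n X \<in> carrier_mat (d * n) (d * n)"
  unfolding pencil_def by (intro minus_carrier_mat) (simp add: mat_sum_def)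

lemma pencil_sym:
  assumes "A \<in> SM_level d" "X \<in> SM_level n"
  shows "(pencil d A n X)\<^sup>T = pencil d A n X"
  using kronecker_sum_sym[OF assms] kronecker_sum_carrier[of d A n X]
  unfolding pencil_def kronecker_sum_def[symmetric] by (simp add: transpose_minus[of _ "d * n" "d * n"])

lemma pencil_flat:
  assumes A: "A \<in> SM_level d" and X: "X \<in> SM_level n"
    and w: "\<And>a. w a \<in> carrier_vec n" and w': "\<And>a. w' a \<in> carrier_vec n"
  shows "flat d n w \<bullet> (pencil d A n X *\<^sub>v flat d n w') = pencil_form d A X w w'"
proof -
  let ?K = "kronecker_sum d A n X"
  have K: "?K \<in> carrier_mat (d * n) (d * n)" by (rule kronecker_sum_carrier)
  have "pencil d A n X *\<^sub>v flat d n w' = flat d n w' - ?K *\<^sub>v flat d n w'"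
    unfolding pencil_def kronecker_sum_def[symmetric]
    using K by (subst minus_mult_distrib_mat_vec[of _ "d * n" "d * n"]) auto
  also have "flat d n w \<bullet> \<dots> = flat d n w \<bullet> flat d n w' - flat d n w \<bullet> (?K *\<^sub>v flat d n w')"
    using K mult_mat_vec_carrier[OF K flat_carrier]
    by (intro scalar_prod_minus_distrib[where n = "d * n"]) auto
  finally show ?thesis
    by (simp add: pencil_form_def flat_scalar_prod[OF w w'] kronecker_sum_form[OF A X w w'])
qed

lemma psd_pencil_iff:
  assumes A: "A \<in> SM_level d" and X: "X \<in> SM_level n"
  shows "psd (pencil d A n X) \<longleftrightarrow> (\<forall>w. (\<forall>a. w a \<in> carrier_vec n) \<longrightarrow> 0 \<le> pencil_form d A X w w)"
proof
  assume "psd (pencil d A n X)"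
  then show "\<forall>w. (\<forall>a. w a \<in> carrier_vec n) \<longrightarrow> 0 \<le> pencil_form d A X w w"
  proof (intro allI impI)
    fix w :: "nat \<Rightarrow> real vec" assume "\<forall>a. w a \<in> carrier_vec n"
    then have w: "\<And>a. w a \<in> carrier_vec n" by simp
    show "0 \<le> pencil_form d A X w w"
      using \<open>psd (pencil d A n X)\<close> psd_iff[OF pencil_carrier, of d A n X] flat_carrier
        pencil_flat[where w = w and w' = w, OF A X w w] by metis
  qed
next
  assume *: "\<forall>w. (\<forall>a. w a \<in> carrier_vec n) \<longrightarrow> 0 \<le> pencil_form d A X w w"
  have "0 \<le> v \<bullet> (pencil d A n X *\<^sub>v v)" if v: "v \<in> carrier_vec (d * n)" for v
  proof -
    obtain w where w: "\<And>a. w a \<in> carrier_vec n" "flat d n w = v"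
      using flat_surj[OF v] by blast
    then show ?thesis
      using * pencil_flat[where w = w and w' = w, OF A X w(1) w(1)] by simp
  qed
  then show "psd (pencil d A n X)"
    using psd_iff[OF pencil_carrier, of d A n X] pencil_sym[OF A X] by blast
qed

text \<open>A tuple of size \<open>n\<close> can enter the union only at level \<open>n\<close>,
  since its size is determined. From here on positivity is tested on families.\<close>

lemma mem_free_spectrahedron_iff:
  assumes "A \<in> SM_level d" "X \<in> SM_level n"
  shows "X \<in> free_spectrahedron d A \<longleftrightarrow>
    1 \<le> n \<and> (\<forall>w. (\<forall>a. w a \<in> carrier_vec n) \<longrightarrow> 0 \<le> pencil_form d A X w w)"
proof -
  have "X \<in> free_spectrahedron d A \<longleftrightarrow> 1 \<le> n \<and> psd (pencil d A n X)"
    using SM_level_unique[OF assms(2)] assms(2) unfolding free_spectrahedron_def by blast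
  then show ?thesis
    by (simp add: psd_pencil_iff[OF assms])
qed

lemma free_spectrahedron_SM_level:
  assumes "X \<in> free_spectrahedron d A"
  obtains n where "1 \<le> n" "X \<in> SM_level n"
  using assms by (auto simp: free_spectrahedron_def)

text \<open>A null vector of a semidefinite matrix lies in its kernel, so it pairs to zero with
  every family; this extracts linear conditions from a quadratic one.\<close>

lemma pencil_form_null:
  assumes A: "A \<in> SM_level d" and X: "X \<in> SM_level n" "X \<in> free_spectrahedron d A"
    and w: "\<And>a. w a \<in> carrier_vec n" "pencil_form d A X w w = 0"
    and w': "\<And>a. w' a \<in> carrier_vec n"
  shows "pencil_form d A X w' w = 0"
proof -
  have "psd (pencil d A n X)"
    using X psd_pencil_iff[OF A X(1)] mem_free_spectrahedron_iff[OF A X(1)] by blast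
  then have "pencil d A n X *\<^sub>v flat d n w = 0\<^sub>v (d * n)"
    using psd_null_vector[OF pencil_carrier _ flat_carrier, of d A n X w]
      pencil_flat[where w = w and w' = w, OF A X(1) w(1) w(1)] w(2) by simp
  then show ?thesis
    using pencil_flat[where w = w' and w' = w, OF A X(1) w' w(1)] by simp
qed

text \<open>The expression in the conclusion is the form of the pencil at \<open>X + t B\<close>.
  Both signs of \<open>t\<close> are covered, which is what a face argument asks for.\<close>

lemma pencil_perturbation:
  assumes A: "A \<in> SM_level d" and X: "X \<in> SM_level n" "X \<in> free_spectrahedron d A" and B: "B \<in> SM_level n"
    and ker: "\<And>w w'. (\<And>a. w a \<in> carrier_vec n) \<Longrightarrow> (\<And>a. w' a \<in> carrier_vec n) \<Longrightarrow>
      pencil_form d A X w w = 0 \<Longrightarrow> pencil_lin d A B w' w = 0"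
  obtains \<epsilon> where "\<epsilon> > 0"
    "\<And>t w. \<bar>t\<bar> \<le> \<epsilon> \<Longrightarrow> (\<And>a. w a \<in> carrier_vec n) \<Longrightarrow>
       0 \<le> pencil_form d A X w w - t * pencil_lin d A B w w"
proof -
  let ?S = "kronecker_sum d A n B"
  have "psd (pencil d A n X)"
    using X psd_pencil_iff[OF A X(1)] mem_free_spectrahedron_iff[OF A X(1)] by blast
  moreover have "?S *\<^sub>v v = 0\<^sub>v (d * n)"
    if v: "v \<in> carrier_vec (d * n)" "pencil d A n X *\<^sub>v v = 0\<^sub>v (d * n)" for v
  proof -
    obtain w where w: "\<And>a. w a \<in> carrier_vec n" "flat d n w = v"
      using flat_surj[OF v(1)] by blast
    have "pencil_form d A X w w = 0"
      using pencil_flat[where w = w and w' = w, OF A X(1) w(1) w(1)] v w(2) by simp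
    \<comment> \<open>The vector is tested against itself: its squared length is a value of the
      bilinear form whose second argument is the null family \<open>w\<close>.\<close>
    let ?y = "?S *\<^sub>v v"
    have y: "?y \<in> carrier_vec (d * n)"
      by (rule mult_mat_vec_carrier[OF kronecker_sum_carrier v(1)])
    obtain w' where w': "\<And>a. w' a \<in> carrier_vec n" "flat d n w' = ?y"
      using flat_surj[OF y] by blast
    have "?y \<bullet> ?y = pencil_lin d A B w' w"
      using kronecker_sum_form[where w = w' and w' = w, OF A B w'(1) w(1)] w w' by simp
    also have "\<dots> = 0"
      using ker w w' \<open>pencil_form d A X w w = 0\<close> by blast
    finally show ?thesis
      using scalar_prod_self_eq_0_iff[OF y] by simp
  qed
  ultimately obtain \<epsilon> where \<epsilon>: "\<epsilon> > 0"
    "\<And>t v. \<bar>t\<bar> \<le> \<epsilon> \<Longrightarrow> v \<in> carrier_vec (d * n) \<Longrightarrow>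
      0 \<le> v \<bullet> (pencil d A n X *\<^sub>v v) + t * (v \<bullet> (?S *\<^sub>v v))"
    using psd_perturbation[OF pencil_carrier _ kronecker_sum_carrier kronecker_sum_sym[OF A B]] by metis
  show ?thesis
  proof (rule that[OF \<epsilon>(1)])
    fix t :: real and w :: "nat \<Rightarrow> real vec"
    assume "\<bar>t\<bar> \<le> \<epsilon>" and w: "\<And>a. w a \<in> carrier_vec n"
    then show "0 \<le> pencil_form d A X w w - t * pencil_lin d A B w w"
      using \<epsilon>(2)[of "-t" "flat d n w"] pencil_flat[where w = w and w' = w, OF A X(1) w w]
        kronecker_sum_form[where w = w and w' = w, OF A B w w] by simp
  qed
qed

section \<open>Compressions of tuples and of their pencils\<close>

lemma compress_SM_level:
  assumes "Y \<in> SM_level N" "V \<in> carrier_mat N n"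
  shows "compress V Y \<in> SM_level n"
proof -
  have "V\<^sup>T * Y i * V \<in> carrier_mat n n \<and> (V\<^sup>T * Y i * V)\<^sup>T = V\<^sup>T * Y i * V" for i
  proof -
    have Y: "Y i \<in> carrier_mat N N" "(Y i)\<^sup>T = Y i"
      using SM_level_carrier[OF assms(1)] SM_level_sym[OF assms(1)] by auto
    then have "(V\<^sup>T * Y i * V)\<^sup>T = V\<^sup>T * (V\<^sup>T * Y i)\<^sup>T"
      using assms(2) by (intro transpose_mult[of _ n N _ n]) auto
    also have "(V\<^sup>T * Y i)\<^sup>T = Y i * V"
      using assms(2) Y by (simp add: transpose_mult[of _ n N _ N])
    also have "V\<^sup>T * (Y i * V) = V\<^sup>T * Y i * V"
      using assms(2) Y by (intro assoc_mult_mat[symmetric]) auto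
    finally show ?thesis using assms(2) Y by auto
  qed
  then show ?thesis by (simp add: SM_level_def compress_def)
qed

lemma compress_scalar_prod:
  assumes "Y \<in> SM_level N" "V \<in> carrier_mat N n" "x \<in> carrier_vec n" "y \<in> carrier_vec n"
  shows "x \<bullet> (compress V Y i *\<^sub>v y) = (V *\<^sub>v x) \<bullet> (Y i *\<^sub>v (V *\<^sub>v y))"
proof -
  have Y: "Y i \<in> carrier_mat N N" by (rule SM_level_carrier[OF assms(1)])
  have "compress V Y i *\<^sub>v y = V\<^sup>T *\<^sub>v (Y i *\<^sub>v (V *\<^sub>v y))"
    using Y assms by (simp add: compress_def assoc_mult_mat_vec[of _ n N _ n])
  then show ?thesis
    using scalar_prod_adjoint[OF assms(2,3)] Y assms by simp
qed

lemma isometry_scalar_prod: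
  fixes V :: "real mat"
  assumes "V \<in> carrier_mat N n" "V\<^sup>T * V = 1\<^sub>m n" "x \<in> carrier_vec n" "y \<in> carrier_vec n"
  shows "(V *\<^sub>v x) \<bullet> (V *\<^sub>v y) = x \<bullet> y"
proof -
  have "V\<^sup>T *\<^sub>v (V *\<^sub>v y) = (V\<^sup>T * V) *\<^sub>v y"
    using assms by (intro assoc_mult_mat_vec[symmetric]) auto
  then show ?thesis
    using scalar_prod_adjoint[OF assms(1,3), of "V *\<^sub>v y"] assms by simp
qed

lemma pencil_lin_compress:
  assumes "Y \<in> SM_level N" "V \<in> carrier_mat N n"
    and "\<And>a. w a \<in> carrier_vec n" "\<And>a. w' a \<in> carrier_vec n"
  shows "pencil_lin d A (compress V Y) w w' = pencil_lin d A Y (\<lambda>a. V *\<^sub>v w a) (\<lambda>a. V *\<^sub>v w' a)"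
  using assms by (simp add: pencil_lin_def compress_scalar_prod)

lemma pencil_form_compress:
  assumes "Y \<in> SM_level N" "V \<in> carrier_mat N n" "V\<^sup>T * V = 1\<^sub>m n"
    and "\<And>a. w a \<in> carrier_vec n" "\<And>a. w' a \<in> carrier_vec n"
  shows "pencil_form d A (compress V Y) w w' = pencil_form d A Y (\<lambda>a. V *\<^sub>v w a) (\<lambda>a. V *\<^sub>v w' a)"
  using assms by (simp add: pencil_form_def pencil_lin_compress isometry_scalar_prod)

lemma free_spectrahedron_compress:
  assumes A: "A \<in> SM_level d" and Y: "Y \<in> SM_level N" "Y \<in> free_spectrahedron d A"
    and V: "V \<in> carrier_mat N n" "V\<^sup>T * V = 1\<^sub>m n" and n: "1 \<le> n"
  shows "compress V Y \<in> free_spectrahedron d A"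
  unfolding mem_free_spectrahedron_iff[OF A compress_SM_level[OF Y(1) V(1)]]
proof (intro conjI allI impI n)
  fix w :: "nat \<Rightarrow> real vec"
  assume w: "\<forall>a. w a \<in> carrier_vec n"
  then have "0 \<le> pencil_form d A Y (\<lambda>a. V *\<^sub>v w a) (\<lambda>a. V *\<^sub>v w a)"
    using Y(2) V(1) unfolding mem_free_spectrahedron_iff[OF A Y(1)] by simp
  then show "0 \<le> pencil_form d A (compress V Y) w w"
    using w by (simp add: pencil_form_compress[OF Y(1) V])
qed

section \<open>Numerical values and the matrix affine hull\<close>

text \<open>For a unit vector \<open>x\<close> this is a point of the joint numerical range of
  \<open>X\<close>; for general \<open>x\<close> it scales quadratically. It carries questions about
  tuples of any size to points of Euclidean space.\<close>

definition numval :: "('h::finite \<Rightarrow> real mat) \<Rightarrow> real vec \<Rightarrow> real ^ 'h" where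
  "numval X x = vec_lambda (\<lambda>i. x \<bullet> (X i *\<^sub>v x))"

lemma numval_nth [simp]: "vec_nth (numval X x) i = x \<bullet> (X i *\<^sub>v x)"
  by (simp add: numval_def)

lemma smult_scalar_prod_mat:
  fixes M :: "real mat"
  assumes "M \<in> carrier_mat n n" "x \<in> carrier_vec n" "y \<in> carrier_vec n"
  shows "(a \<cdot>\<^sub>v x) \<bullet> (M *\<^sub>v (b \<cdot>\<^sub>v y)) = a * b * (x \<bullet> (M *\<^sub>v y))"
  using assms mult_mat_vec_carrier[OF assms(1,3)]
  by (simp add: mult_mat_vec[of _ n n] smult_scalar_prod_distrib[of _ n] scalar_prod_smult_distrib[of _ n])

lemma numval_smult:
  assumes "X \<in> SM_level n" "x \<in> carrier_vec n"
  shows "numval X (c \<cdot>\<^sub>v x) = c\<^sup>2 *\<^sub>R numval X x"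
  using assms SM_level_carrier[OF assms(1)]
  by (simp add: Finite_Cartesian_Product.vec_eq_iff smult_scalar_prod_mat[of _ n] power2_eq_square)

lemma numval_zero:
  assumes "X \<in> SM_level n"
  shows "numval X (0\<^sub>v n) = 0"
proof -
  have "0 \<cdot>\<^sub>v (0\<^sub>v n :: real vec) = 0\<^sub>v n" by auto
  then show ?thesis
    using numval_smult[OF assms, of "0\<^sub>v n" 0] by simp
qed

lemma numval_compress:
  assumes "Y \<in> SM_level N" "V \<in> carrier_mat N n" "x \<in> carrier_vec n"
  shows "numval (compress V Y) x = numval Y (V *\<^sub>v x)"
  using assms by (simp add: Finite_Cartesian_Product.vec_eq_iff compress_scalar_prod)

lemma unit_multiple:
  fixes x :: "real vec"
  assumes "x \<in> carrier_vec n" "x \<noteq> 0\<^sub>v n"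
  obtains e where "e \<in> carrier_vec n" "e \<bullet> e = 1" "x = sqrt (x \<bullet> x) \<cdot>\<^sub>v e" "0 < x \<bullet> x"
proof (rule that[of "(1 / sqrt (x \<bullet> x)) \<cdot>\<^sub>v x"])
  have "x \<bullet> x \<noteq> 0" using assms scalar_prod_self_eq_0_iff by blast
  then show pos: "0 < x \<bullet> x" using scalar_prod_self_nonneg[of x] by simp
  show "((1 / sqrt (x \<bullet> x)) \<cdot>\<^sub>v x) \<bullet> ((1 / sqrt (x \<bullet> x)) \<cdot>\<^sub>v x) = 1"
    using pos assms by (simp add: field_simps)
  show "x = sqrt (x \<bullet> x) \<cdot>\<^sub>v ((1 / sqrt (x \<bullet> x)) \<cdot>\<^sub>v x)"
    using pos assms by (simp add: smult_smult_assoc)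
qed (use assms in simp)

section \<open>Tuples of size one\<close>

lemma scalar_tuple_SM_level [simp]: "scalar_tuple y \<in> SM_level 1"
  by (auto simp: SM_level_def scalar_tuple_def)

lemma scalar_tuple_scalar_prod:
  assumes "v \<in> carrier_vec 1" "w \<in> carrier_vec 1"
  shows "v \<bullet> (scalar_tuple y i *\<^sub>v w) = v $ 0 * w $ 0 * vec_nth y i"
  using assms by (simp add: scalar_tuple_def scalar_prod_def)

lemma scalar_prod_dim_1:
  assumes "w \<in> carrier_vec 1"
  shows "v \<bullet> w = v $ 0 * w $ 0"
  using assms by (simp add: scalar_prod_def)

lemma numval_scalar_tuple:
  assumes "v \<in> carrier_vec 1"
  shows "numval (scalar_tuple y) v = (v \<bullet> v) *\<^sub>R y"
  using assms by (simp add: Finite_Cartesian_Product.vec_eq_iff scalar_tuple_scalar_prod scalar_prod_dim_1)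

text \<open>The form of level one with real coefficients in place of vectors of length one, so that
  its arguments can be tensored with a vector \<open>x\<close> of any size.\<close>

definition scalar_pencil_lin :: "nat \<Rightarrow> ('h::finite \<Rightarrow> real mat) \<Rightarrow> real ^ 'h \<Rightarrow> (nat \<Rightarrow> real) \<Rightarrow> (nat \<Rightarrow> real) \<Rightarrow> real" where
  "scalar_pencil_lin d A y u u' = (\<Sum>i\<in>UNIV. \<Sum>a<d. \<Sum>b<d. A i $$ (a, b) * (u a * u' b * vec_nth y i))"

definition scalar_pencil_form :: "nat \<Rightarrow> ('h::finite \<Rightarrow> real mat) \<Rightarrow> real ^ 'h \<Rightarrow> (nat \<Rightarrow> real) \<Rightarrow> (nat \<Rightarrow> real) \<Rightarrow> real" where
  "scalar_pencil_form d A y u u' = (\<Sum>a<d. u a * u' a) - scalar_pencil_lin d A y u u'"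

lemma scalar_pencil_lin_linear:
  "scalar_pencil_lin d A (y + z) u u' = scalar_pencil_lin d A y u u' + scalar_pencil_lin d A z u u'"
  "scalar_pencil_lin d A (c *\<^sub>R y) u u' = c * scalar_pencil_lin d A y u u'"
  by (simp_all add: scalar_pencil_lin_def algebra_simps sum.distrib sum_distrib_left)

lemma scalar_pencil_form_affine:
  assumes "s + t = 1"
  shows "scalar_pencil_form d A (s *\<^sub>R y + t *\<^sub>R z) u u' =
    s * scalar_pencil_form d A y u u' + t * scalar_pencil_form d A z u u'"
proof -
  have "(\<Sum>a<d. u a * u' a) = (s + t) * (\<Sum>a<d. u a * u' a)" using assms by simp
  then show ?thesis
    unfolding scalar_pencil_form_def scalar_pencil_lin_linear by (simp add: algebra_simps)
qed

lemma pencil_lin_tensor: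
  assumes X: "X \<in> SM_level n" and x: "x \<in> carrier_vec n"
  shows "pencil_lin d A X (\<lambda>a. u a \<cdot>\<^sub>v x) (\<lambda>a. u' a \<cdot>\<^sub>v x) = scalar_pencil_lin d A (numval X x) u u'"
proof -
  have "(u a \<cdot>\<^sub>v x) \<bullet> (X i *\<^sub>v (u' b \<cdot>\<^sub>v x)) = u a * u' b * vec_nth (numval X x) i" for i a b
    by (simp only: numval_nth smult_scalar_prod_mat[OF SM_level_carrier[OF X] x x])
  then show ?thesis by (simp add: pencil_lin_def scalar_pencil_lin_def)
qed

text \<open>On elementary tensors the form of \<open>X\<close> sees only the numerical value at
  \<open>x\<close>. Writing this value as a multiple of \<open>y\<close> turns null vectors of the
  pencil at \<open>y\<close> into null families for \<open>X\<close>.\<close>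

lemma pencil_form_tensor:
  assumes X: "X \<in> SM_level n" and x: "x \<in> carrier_vec n" and "numval X x = (x \<bullet> x) *\<^sub>R y"
  shows "pencil_form d A X (\<lambda>a. u a \<cdot>\<^sub>v x) (\<lambda>a. u' a \<cdot>\<^sub>v x) = (x \<bullet> x) * scalar_pencil_form d A y u u'"
proof -
  have "(u a \<cdot>\<^sub>v x) \<bullet> (u' a \<cdot>\<^sub>v x) = (x \<bullet> x) * (u a * u' a)" for a
    using x by simp
  then have "pencil_form d A X (\<lambda>a. u a \<cdot>\<^sub>v x) (\<lambda>a. u' a \<cdot>\<^sub>v x) =
      (x \<bullet> x) * (\<Sum>a<d. u a * u' a) - (x \<bullet> x) * scalar_pencil_lin d A y u u'"
    unfolding pencil_form_def pencil_lin_tensor[OF X x] assms(3) scalar_pencil_lin_linear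
    by (simp add: sum_distrib_left ac_simps)
  then show ?thesis by (simp add: scalar_pencil_form_def algebra_simps)
qed

lemma pencil_lin_scalar_tuple:
  assumes "\<And>a. w a \<in> carrier_vec 1" "\<And>a. w' a \<in> carrier_vec 1"
  shows "pencil_lin d A (scalar_tuple y) w w' = scalar_pencil_lin d A y (\<lambda>a. w a $ 0) (\<lambda>a. w' a $ 0)"
  using assms by (simp add: pencil_lin_def scalar_pencil_lin_def scalar_tuple_scalar_prod)

lemma pencil_form_scalar_tuple:
  assumes "\<And>a. w a \<in> carrier_vec 1" "\<And>a. w' a \<in> carrier_vec 1"
  shows "pencil_form d A (scalar_tuple y) w w' = scalar_pencil_form d A y (\<lambda>a. w a $ 0) (\<lambda>a. w' a $ 0)"
  using assms by (simp add: pencil_form_def scalar_pencil_form_def pencil_lin_scalar_tuple scalar_prod_dim_1)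

lemma mem_level_one_iff:
  assumes A: "A \<in> SM_level d"
  shows "y \<in> level_one (free_spectrahedron d A) \<longleftrightarrow> (\<forall>u. 0 \<le> scalar_pencil_form d A y u u)"
proof -
  have "(\<forall>w. (\<forall>a. w a \<in> carrier_vec 1) \<longrightarrow> 0 \<le> pencil_form d A (scalar_tuple y) w w) \<longleftrightarrow>
      (\<forall>u. 0 \<le> scalar_pencil_form d A y u u)"
  proof (intro iffI allI impI)
    fix u :: "nat \<Rightarrow> real"
    assume *: "\<forall>w. (\<forall>a. w a \<in> carrier_vec 1) \<longrightarrow> 0 \<le> pencil_form d A (scalar_tuple y) w w"
    let ?w = "\<lambda>a. vec 1 (\<lambda>_. u a)"
    have "0 \<le> pencil_form d A (scalar_tuple y) ?w ?w" using * by simp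
    then show "0 \<le> scalar_pencil_form d A y u u" by (simp add: pencil_form_scalar_tuple)
  qed (simp add: pencil_form_scalar_tuple)
  then show ?thesis
    by (simp add: level_one_def mem_free_spectrahedron_iff[OF A scalar_tuple_SM_level])
qed

lemma convex_level_one:
  assumes "A \<in> SM_level d"
  shows "convex (level_one (free_spectrahedron d A))"
  unfolding convex_def by (simp add: mem_level_one_iff[OF assms] scalar_pencil_form_affine)

text \<open>Positivity of the pencil of \<open>X\<close> is restricted to elementary tensors with
  second factor \<open>x\<close>.\<close>

lemma numval_level_one:
  assumes A: "A \<in> SM_level d" and X: "X \<in> SM_level n" "X \<in> free_spectrahedron d A"
    and x: "x \<in> carrier_vec n" "x \<bullet> x = 1"
  shows "numval X x \<in> level_one (free_spectrahedron d A)"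
proof -
  have "0 \<le> scalar_pencil_form d A (numval X x) u u" for u
  proof -
    have "0 \<le> pencil_form d A X (\<lambda>a. u a \<cdot>\<^sub>v x) (\<lambda>a. u a \<cdot>\<^sub>v x)"
      using X(2) x unfolding mem_free_spectrahedron_iff[OF A X(1)] by simp
    then show ?thesis using pencil_form_tensor[OF X(1) x(1), of "numval X x"] x by simp
  qed
  then show ?thesis by (simp add: mem_level_one_iff[OF A])
qed

section \<open>Numerical values of matrix convex combinations\<close>

lemma mat_sum_scalar_prod:
  assumes "\<And>l. l \<in> I \<Longrightarrow> M l \<in> carrier_mat n n" "x \<in> carrier_vec n" "y \<in> carrier_vec n"
  shows "x \<bullet> (mat_sum n M I *\<^sub>v y) = (\<Sum>l\<in>I. x \<bullet> (M l *\<^sub>v y))"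
proof -
  have "x \<bullet> (mat_sum n M I *\<^sub>v y) = (\<Sum>r<n. \<Sum>s<n. \<Sum>l\<in>I. x $ r * (M l $$ (r, s) * y $ s))"
    using assms(2,3) by (simp add: mat_sum_def scalar_prod_def lessThan_atLeast0 sum_distrib_left sum_distrib_right)
  also have "\<dots> = (\<Sum>r<n. \<Sum>l\<in>I. \<Sum>s<n. x $ r * (M l $$ (r, s) * y $ s))"
    by (intro sum.cong refl sum.swap)
  also have "\<dots> = (\<Sum>l\<in>I. \<Sum>r<n. \<Sum>s<n. x $ r * (M l $$ (r, s) * y $ s))"
    by (rule sum.swap)
  also have "\<dots> = (\<Sum>l\<in>I. x \<bullet> (M l *\<^sub>v y))"
  proof (rule sum.cong[OF refl])
    fix l assume "l \<in> I"
    then have "M l \<in> carrier_mat n n" by (rule assms(1))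
    then show "(\<Sum>r<n. \<Sum>s<n. x $ r * (M l $$ (r, s) * y $ s)) = x \<bullet> (M l *\<^sub>v y)"
      using assms(2,3) by (simp add: scalar_prod_def lessThan_atLeast0 sum_distrib_left)
  qed
  finally show ?thesis .
qed

text \<open>These are the weights with which \<open>mat_conv_comb_numval\<close> averages: after
  normalization a matrix convex combination becomes an ordinary convex combination of
  points.\<close>

lemma mat_conv_comb_unit:
  assumes "mat_conv_comb K n m N V Y X" "x \<in> carrier_vec n"
  shows "x \<bullet> x = (\<Sum>l<m. (V l *\<^sub>v x) \<bullet> (V l *\<^sub>v x))"
proof -
  have V: "V l \<in> carrier_mat (N l) n" if "l < m" for l
    using assms that by (simp add: mat_conv_comb_def)
  have "x \<bullet> x = x \<bullet> (mat_sum n (\<lambda>l. (V l)\<^sup>T * V l) {..<m} *\<^sub>v x)"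
    using assms by (simp add: mat_conv_comb_def)
  also have "\<dots> = (\<Sum>l<m. x \<bullet> ((V l)\<^sup>T * V l *\<^sub>v x))"
  proof (intro mat_sum_scalar_prod assms(2))
    fix l assume "l \<in> {..<m}"
    then show "(V l)\<^sup>T * V l \<in> carrier_mat n n"
      using V by (intro mult_carrier_mat[of _ n "N l"]) auto
  qed
  also have "\<dots> = (\<Sum>l<m. (V l *\<^sub>v x) \<bullet> (V l *\<^sub>v x))"
  proof (rule sum.cong[OF refl])
    fix l assume "l \<in> {..<m}"
    then have "V l \<in> carrier_mat (N l) n" by (simp add: V)
    then show "x \<bullet> ((V l)\<^sup>T * V l *\<^sub>v x) = (V l *\<^sub>v x) \<bullet> (V l *\<^sub>v x)"
      using assms(2) by (simp add: scalar_prod_adjoint[of _ "N l" n] assoc_mult_mat_vec[of _ n "N l" _ n])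
  qed
  finally show ?thesis .
qed

lemma mat_conv_comb_numval:
  assumes "mat_conv_comb K n m N V Y X" "x \<in> carrier_vec n"
  shows "numval X x = (\<Sum>l<m. numval (Y l) (V l *\<^sub>v x))"
proof -
  have V: "Y l \<in> SM_level (N l)" "V l \<in> carrier_mat (N l) n" if "l < m" for l
    using assms that by (simp_all add: mat_conv_comb_def level_def)
  have "x \<bullet> (X i *\<^sub>v x) = (\<Sum>l<m. (V l *\<^sub>v x) \<bullet> (Y l i *\<^sub>v (V l *\<^sub>v x)))" for i
  proof -
    have "x \<bullet> (X i *\<^sub>v x) = x \<bullet> (mat_sum n (\<lambda>l. compress (V l) (Y l) i) {..<m} *\<^sub>v x)"
      using assms by (simp add: mat_conv_comb_def)
    also have "\<dots> = (\<Sum>l<m. x \<bullet> (compress (V l) (Y l) i *\<^sub>v x))"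
      using V assms by (intro mat_sum_scalar_prod) (auto intro: SM_level_carrier compress_SM_level)
    also have "\<dots> = (\<Sum>l<m. (V l *\<^sub>v x) \<bullet> (Y l i *\<^sub>v (V l *\<^sub>v x)))"
      using V assms(2) by (intro sum.cong refl compress_scalar_prod) auto
    finally show ?thesis .
  qed
  then show ?thesis by (simp add: Finite_Cartesian_Product.vec_eq_iff)
qed

lemma mat_conv_comb_SM_level:
  assumes "mat_conv_comb K n m N V Y X"
  shows "X \<in> SM_level n"
proof -
  have *: "compress (V l) (Y l) \<in> SM_level n" if "l < m" for l
    using assms that by (auto simp: mat_conv_comb_def level_def intro: compress_SM_level)
  have "compress (V l) (Y l) i $$ (s, r) = compress (V l) (Y l) i $$ (r, s)"
    if "l < m" "r < n" "s < n" for l i r s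
    using SM_level_carrier[OF *[OF that(1)], of i] that
      arg_cong[OF SM_level_sym[OF *[OF that(1)], of i], of "\<lambda>M. M $$ (r, s)"] by simp
  moreover have "X = (\<lambda>i. mat_sum n (\<lambda>l. compress (V l) (Y l) i) {..<m})"
    using assms by (simp add: mat_conv_comb_def)
  ultimately show ?thesis
    by (auto simp: SM_level_def mat_sum_def intro!: eq_matI)
qed

section \<open>Unit vector test for the matrix affine hull\<close>

lemma affine_mem_sum:
  fixes y :: "'i \<Rightarrow> 'a::real_vector"
  assumes S: "affine S" and y: "\<And>i. i \<in> I \<Longrightarrow> y i \<in> S" and sum: "(\<Sum>i\<in>I. c i) = 1"
  shows "(\<Sum>i\<in>I. c i *\<^sub>R y i) \<in> S"
proof -
  have "I \<noteq> {}" using sum by auto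
  then obtain s where s: "s \<in> S" using y by blast
  \<comment> \<open>Translated by \<open>s\<close> the affine set is a subspace; weights of total 1
    restore the translation.\<close>
  have sub: "subspace ((\<lambda>x. x - s) ` S)"
    by (rule affine_diffs_subspace_subtract[OF S s])
  have "(\<Sum>i\<in>I. c i *\<^sub>R (y i - s)) \<in> (\<lambda>x. x - s) ` S"
    using y by (intro subspace_sum[OF sub] subspace_scale[OF sub]) auto
  moreover have "(\<Sum>i\<in>I. c i *\<^sub>R (y i - s)) = (\<Sum>i\<in>I. c i *\<^sub>R y i) - s"
    using sum by (simp add: scaleR_diff_right sum_subtractf flip: scaleR_left.sum)
  ultimately show ?thesis by auto
qed

text \<open>All summands have size one, so each \<open>V l\<close> is a row, and the value at
  \<open>x\<close> is an affine combination of points of the hull with the squared lengths of the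
  \<open>V l x\<close> as weights.\<close>

lemma aff_mat_numval:
  assumes X: "X \<in> aff_mat F" "X \<in> SM_level n" and x: "x \<in> carrier_vec n" "x \<bullet> x = 1"
  shows "numval X x \<in> affine hull F"
proof -
  obtain n' m N V Y where comb: "mat_conv_comb (scalar_tuple ` (affine hull F)) n' m N V Y X"
    using X by (auto simp: aff_mat_def co_mat_def)
  have n': "n' = n"
    using SM_level_unique[OF mat_conv_comb_SM_level[OF comb] X(2)] .
  note comb = comb[unfolded n']
  have Y: "\<exists>y\<in>affine hull F. Y l = scalar_tuple y" and V: "V l \<in> carrier_mat 1 n" if "l < m" for l
  proof -
    have "Y l \<in> level (scalar_tuple ` (affine hull F)) (N l)" "V l \<in> carrier_mat (N l) n"
      using comb that by (simp_all add: mat_conv_comb_def)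
    then obtain y where y: "y \<in> affine hull F" "Y l = scalar_tuple y" "Y l \<in> SM_level (N l)"
      by (auto simp: level_def)
    then have "N l = 1" using SM_level_unique[OF _ scalar_tuple_SM_level] by metis
    then show "\<exists>y\<in>affine hull F. Y l = scalar_tuple y" "V l \<in> carrier_mat 1 n"
      using y \<open>V l \<in> carrier_mat (N l) n\<close> by auto
  qed
  obtain y where y: "\<And>l. l < m \<Longrightarrow> y l \<in> affine hull F" "\<And>l. l < m \<Longrightarrow> Y l = scalar_tuple (y l)"
    using Y by metis
  have "numval X x = (\<Sum>l<m. ((V l *\<^sub>v x) \<bullet> (V l *\<^sub>v x)) *\<^sub>R y l)"
    unfolding mat_conv_comb_numval[OF comb x(1)]
  proof (rule sum.cong[OF refl])
    fix l assume "l \<in> {..<m}"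
    then have "l < m" by simp
    then have "V l *\<^sub>v x \<in> carrier_vec 1" using V x by (meson mult_mat_vec_carrier)
    then show "numval (Y l) (V l *\<^sub>v x) = ((V l *\<^sub>v x) \<bullet> (V l *\<^sub>v x)) *\<^sub>R y l"
      using y(2)[OF \<open>l < m\<close>] by (simp add: numval_scalar_tuple)
  qed
  also have "\<dots> \<in> affine hull F"
    using y mat_conv_comb_unit[OF comb x(1)] x(2) by (intro affine_mem_sum) auto
  finally show ?thesis .
qed

lemma co_matI:
  fixes Y :: "'l \<Rightarrow> 'h \<Rightarrow> real mat"
  assumes I: "finite I" and n: "1 \<le> n"
    and Y: "\<And>l. l \<in> I \<Longrightarrow> Y l \<in> level K (N l)" "\<And>l. l \<in> I \<Longrightarrow> V l \<in> carrier_mat (N l) n"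
    and unit: "mat_sum n (\<lambda>l. (V l)\<^sup>T * V l) I = 1\<^sub>m n"
    and X: "X = (\<lambda>i. mat_sum n (\<lambda>l. compress (V l) (Y l) i) I)"
  shows "X \<in> co_mat K"
proof -
  obtain f where f: "bij_betw f {..<card I} I"
    using ex_bij_betw_nat_finite[OF I] by (auto simp: lessThan_atLeast0)
  have sum: "mat_sum n (\<lambda>l. M (f l)) {..<card I} = mat_sum n M I" for M
    unfolding mat_sum_def using sum.reindex_bij_betw[OF f, of "\<lambda>l. M l $$ _"] by simp
  have "mat_conv_comb K n (card I) (N \<circ> f) (V \<circ> f) (Y \<circ> f) X"
    unfolding mat_conv_comb_def
    using Y bij_betwE[OF f] unit X sum[of "\<lambda>l. (V l)\<^sup>T * V l"] sum[of "\<lambda>l. compress (V l) (Y l) _"]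
    by simp
  then show ?thesis using n unfolding co_mat_def by blast
qed

text \<open>
  The combination is explicit: with w in the affine hull and D p j the (p, j) entry of X minus
  w on the diagonal, which is a direction of the hull, take the rows (e_p + e_j) and (e_p - e_j),
  divided by 2 sqrt n, at the points w + n D p j and w - n D p j, over all p, j < n.
\<close>

lemma aff_matI_numval:
  fixes X :: "'h::finite \<Rightarrow> real mat"
  assumes X: "X \<in> SM_level n" and n: "1 \<le> n"
    and W: "\<And>x. x \<in> carrier_vec n \<Longrightarrow> x \<bullet> x = 1 \<Longrightarrow> numval X x \<in> affine hull F"
  shows "X \<in> aff_mat F"
proof -
  let ?e = "unit_vec n :: nat \<Rightarrow> real vec"
  have Xc: "X i \<in> carrier_mat n n" for i by (rule SM_level_carrier[OF X])
  have Xsym: "X i $$ (r, s) = X i $$ (s, r)" if "r < n" "s < n" for i r s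
    using arg_cong[OF SM_level_sym[OF X, of i], of "\<lambda>M. M $$ (s, r)"] Xc[of i] that by simp
  have entry: "?e p \<bullet> (X i *\<^sub>v ?e j) = X i $$ (p, j)" if "p < n" "j < n" for i p j
    using that Xc[of i] by (simp add: mult_unit_vec)
  have e: "numval X (?e p) \<in> affine hull F" if "p < n" for p
    using that by (intro W) auto
  define w where "w = numval X (?e 0)"
  define D where "D p j = (vec_lambda (\<lambda>i. X i $$ (p, j)) - of_bool (p = j) *\<^sub>R w)" for p j
  define L where "L = (\<lambda>x. x - w) ` (affine hull F)"
  have sub: "subspace L"
    unfolding L_def w_def using n by (intro affine_diffs_subspace_subtract e) auto
  have diff: "x - w \<in> L" if "x \<in> affine hull F" for x
    using that by (simp add: L_def)
  have D: "D p j \<in> L" if p: "p < n" "j < n" for p j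
  proof (cases "p = j")
    case True
    have "D p j = numval X (?e p) - w"
      using True p entry by (simp add: D_def Finite_Cartesian_Product.vec_eq_iff)
    then show ?thesis using diff e p by simp
  next
    case False
    \<comment> \<open>Polarization: the value at this unit vector is the mean of two diagonal values
      plus the entry \<open>(p, j)\<close>, so that entry is a combination of directions of the
      hull.\<close>
    define v where "v = (1 / sqrt 2) \<cdot>\<^sub>v (?e p + ?e j)"
    have s2: "1 / sqrt 2 * (1 / sqrt 2) = (1 / 2 :: real)" by (simp add: field_simps)
    have v: "v \<in> carrier_vec n" "v \<bullet> v = 1"
      using p False s2 by (auto simp: v_def add_scalar_prod_distrib[of _ n] scalar_prod_add_distrib[of _ n]
          simp flip: mult.assoc)
    have nv: "vec_nth (numval X v) i = (X i $$ (p, p) + X i $$ (j, j)) / 2 + X i $$ (p, j)" for i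
    proof -
      have "vec_nth (numval X v) i = 1 / 2 * ((?e p + ?e j) \<bullet> (X i *\<^sub>v (?e p + ?e j)))"
        unfolding v_def numval_nth
        by (subst smult_scalar_prod_mat[OF Xc]) (auto simp: s2)
      also have "(?e p + ?e j) \<bullet> (X i *\<^sub>v (?e p + ?e j)) =
          X i $$ (p, p) + X i $$ (j, j) + 2 * X i $$ (p, j)"
        using p Xc[of i] Xsym[of p j i] mult_mat_vec_carrier[OF Xc, of "?e _" i]
        by (simp add: mult_add_distrib_mat_vec[OF Xc] add_scalar_prod_distrib[of _ n]
            scalar_prod_add_distrib[of _ n] mult_unit_vec)
      finally show ?thesis by (simp add: field_simps)
    qed
    have "D p j = (numval X v - w) - (1/2) *\<^sub>R (numval X (?e p) - w) - (1/2) *\<^sub>R (numval X (?e j) - w)"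
      using False p entry nv
      by (simp add: D_def Finite_Cartesian_Product.vec_eq_iff field_simps del: numval_nth)
        (simp add: numval_nth)
    then show ?thesis
      using p e W[OF v] by (simp add: subspace_diff[OF sub] subspace_scale[OF sub] diff)
  qed
  define I where "I = {..<n} \<times> {..<n} \<times> {-1, 1 :: real}"
  \<comment> \<open>A diagonal entry of the sum of the \<open>V\<^sup>T V\<close> is hit
    \<open>n\<close> times through \<open>p\<close> and \<open>n\<close> times through
    \<open>j\<close>, for both signs, hence 4 n c^2 = 1. The mixed terms cancel between the
    signs.\<close>
  define c where "c = 1 / (2 * sqrt (real n))"
  have cc: "4 * real n * (c * c) = 1" using n by (simp add: c_def field_simps)
  define \<delta> where "\<delta> r s = (of_bool (r = s) :: real)" for r s :: nat
  define V where "V = (\<lambda>(p, j, \<sigma>). mat 1 n (\<lambda>(_, q). c * (\<delta> q p + \<sigma> * \<delta> q j)))"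
  \<comment> \<open>Entry \<open>(r, s)\<close> of the result meets the mixed terms only at the
    index pairs \<open>(r, s)\<close> and \<open>(s, r)\<close>; the factor \<open>n\<close> raises
    their total weight to 4 n c^2 = 1 as well.\<close>
  define y where "y = (\<lambda>(p, j, \<sigma>). w + (\<sigma> * real n) *\<^sub>R D p j)"
  have y: "y l \<in> affine hull F" if "l \<in> I" for l
  proof -
    obtain p j \<sigma> where "l = (p, j, \<sigma>)" by (cases l)
    with that have l: "l = (p, j, \<sigma>)" "p < n" "j < n" by (auto simp: I_def)
    have "(\<sigma> * real n) *\<^sub>R D p j \<in> L" using D l by (intro subspace_scale[OF sub]) auto
    then show ?thesis by (auto simp: L_def y_def l(1))
  qed
  have sum_I: "(\<Sum>l\<in>I. f l) = (\<Sum>p<n. \<Sum>j<n. f (p, j, 1) + f (p, j, -1))" for f :: "_ \<Rightarrow> real"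
    unfolding I_def sum.cartesian_product' by (simp add: add.commute)
  have \<delta>1: "(\<Sum>p<n. \<delta> r p * f p) = f r" if "r < n" for r f
    using that by (simp add: \<delta>_def of_bool_def if_distrib[of "\<lambda>x. x * _"] cong: if_cong)
  have VV: "((V l)\<^sup>T * V l) $$ (r, s) = V l $$ (0, r) * V l $$ (0, s)" if "r < n" "s < n" for l r s
    using that by (cases l) (simp add: V_def scalar_prod_def)
  have VyV: "compress (V l) (scalar_tuple (y l)) i $$ (r, s) = V l $$ (0, r) * V l $$ (0, s) * vec_nth (y l) i"
    if "r < n" "s < n" for l r s i
    using that by (cases l) (simp add: V_def scalar_prod_def compress_def scalar_tuple_def)
  have V0: "V (p, j, \<sigma>) $$ (0, r) = c * (\<delta> r p + \<sigma> * \<delta> r j)" if "r < n" for p j \<sigma> r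
    using that by (simp add: V_def)
  have unit: "mat_sum n (\<lambda>l. (V l)\<^sup>T * V l) I = 1\<^sub>m n"
  proof (rule eq_matI)
    fix r s assume "r < dim_row (1\<^sub>m n :: real mat)" "s < dim_col (1\<^sub>m n :: real mat)"
    then have rs: "r < n" "s < n" by auto
    have "mat_sum n (\<lambda>l. (V l)\<^sup>T * V l) I $$ (r, s) = (\<Sum>l\<in>I. V l $$ (0, r) * V l $$ (0, s))"
      unfolding mat_sum_def using rs by (simp add: VV del: index_mult_mat)
    also have "\<dots> = (\<Sum>p<n. \<Sum>j<n. 2 * (c * c) * (\<delta> r p * \<delta> s p + \<delta> r j * \<delta> s j))"
      unfolding sum_I V0[OF rs(1)] V0[OF rs(2)] by (intro sum.cong refl) (simp add: algebra_simps)
    also have "\<dots> = 2 * (c * c) * (real n * (\<Sum>p<n. \<delta> r p * \<delta> s p) + real n * (\<Sum>j<n. \<delta> r j * \<delta> s j))"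
      by (simp add: sum.distrib flip: sum_distrib_left)
    also have "\<dots> = 4 * real n * (c * c) * \<delta> s r"
      unfolding \<delta>1[OF rs(1)] by simp
    finally show "mat_sum n (\<lambda>l. (V l)\<^sup>T * V l) I $$ (r, s) = 1\<^sub>m n $$ (r, s)"
      using rs cc by (auto simp: \<delta>_def)
  qed (auto simp: mat_sum_def)
  have "X i = mat_sum n (\<lambda>l. compress (V l) (scalar_tuple (y l)) i) I" for i
  proof (rule eq_matI)
    fix r s assume "r < dim_row (mat_sum n (\<lambda>l. compress (V l) (scalar_tuple (y l)) i) I)"
      "s < dim_col (mat_sum n (\<lambda>l. compress (V l) (scalar_tuple (y l)) i) I)"
    then have rs: "r < n" "s < n" by (auto simp: mat_sum_def)
    let ?D = "\<lambda>p j. vec_nth (D p j) i"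
    have Dsym: "?D s r = ?D r s" using Xsym[OF rs] by (simp add: D_def eq_commute)
    have "mat_sum n (\<lambda>l. compress (V l) (scalar_tuple (y l)) i) I $$ (r, s) =
        (\<Sum>l\<in>I. V l $$ (0, r) * V l $$ (0, s) * vec_nth (y l) i)"
      unfolding mat_sum_def using rs by (simp add: VyV)
    also have "\<dots> = (\<Sum>p<n. \<Sum>j<n. 2 * (c * c) * vec_nth w i * (\<delta> r p * \<delta> s p + \<delta> r j * \<delta> s j) +
        2 * (c * c) * real n * (\<delta> r p * (\<delta> s j * ?D p j) + \<delta> s p * (\<delta> r j * ?D p j)))"
      unfolding sum_I V0[OF rs(1)] V0[OF rs(2)]
      by (intro sum.cong refl) (simp add: y_def algebra_simps)
    also have "\<dots> = 2 * (c * c) * vec_nth w i *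
          (real n * (\<Sum>p<n. \<delta> r p * \<delta> s p) + real n * (\<Sum>j<n. \<delta> r j * \<delta> s j)) +
        2 * (c * c) * real n * ((\<Sum>p<n. \<delta> r p * (\<Sum>j<n. \<delta> s j * ?D p j)) +
          (\<Sum>p<n. \<delta> s p * (\<Sum>j<n. \<delta> r j * ?D p j)))"
      by (simp add: sum.distrib flip: sum_distrib_left)
    also have "\<dots> = (4 * real n * (c * c)) * (\<delta> s r * vec_nth w i + ?D r s)"
      unfolding \<delta>1[OF rs(1)] \<delta>1[OF rs(2)] Dsym by (simp add: algebra_simps)
    also have "\<dots> = X i $$ (r, s)"
      unfolding cc by (auto simp: \<delta>_def D_def)
    finally show "X i $$ (r, s) = mat_sum n (\<lambda>l. compress (V l) (scalar_tuple (y l)) i) I $$ (r, s)" by simp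
  qed (use Xc in \<open>auto simp: mat_sum_def\<close>)
  then have "X = (\<lambda>i. mat_sum n (\<lambda>l. compress (V l) (scalar_tuple (y l)) i) I)" by auto
  then show ?thesis
    unfolding aff_mat_def using unit y n
    by (intro co_matI[where I = I and Y = "\<lambda>l. scalar_tuple (y l)" and N = "\<lambda>_. 1" and V = V])
      (auto simp: I_def level_def V_def scalar_tuple_SM_level[unfolded One_nat_def])
qed

section \<open>Block tuples and orthogonal equivalence\<close>

definition block_tuple :: "('h \<Rightarrow> real mat) \<Rightarrow> ('h \<Rightarrow> real mat) \<Rightarrow> ('h \<Rightarrow> real mat) \<Rightarrow> 'h \<Rightarrow> real mat" where
  "block_tuple X b Z = (\<lambda>i. four_block_mat (X i) (b i) ((b i)\<^sup>T) (Z i))"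

lemma direct_sum_eq_block_tuple:
  assumes "X \<in> SM_level n" "Z \<in> SM_level k"
  shows "direct_sum X Z = block_tuple X (\<lambda>_. 0\<^sub>m n k) Z"
proof
  fix i
  have "dim_row (X i) = n" "dim_col (X i) = n" "dim_row (Z i) = k" "dim_col (Z i) = k"
    using SM_level_carrier[OF assms(1), of i] SM_level_carrier[OF assms(2), of i] by auto
  moreover have "diag_block_mat [M, M'] =
      four_block_mat M (0\<^sub>m (dim_row M) (dim_col M')) (0\<^sub>m (dim_row M') (dim_col M)) M'" for M M' :: "real mat"
    by (subst diag_block_mat.simps(2)) (simp only: diag_block_mat_singleton Let_def)
  ultimately show "direct_sum X Z i = block_tuple X (\<lambda>_. 0\<^sub>m n k) Z i"
    by (simp add: direct_sum_def block_tuple_def)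
qed

lemma block_tuple_SM_level:
  assumes X: "X \<in> SM_level n" and b: "\<And>i. b i \<in> carrier_mat n k" and Z: "Z \<in> SM_level k"
  shows "block_tuple X b Z \<in> SM_level (n + k)"
  using SM_level_carrier[OF X] SM_level_carrier[OF Z] SM_level_sym[OF X] SM_level_sym[OF Z] b
  by (auto simp: SM_level_def block_tuple_def transpose_four_block_mat[of _ n n _ k _ k])

lemma block_tuple_scalar_prod:
  assumes X: "X \<in> SM_level n" and b: "\<And>i. b i \<in> carrier_mat n k" and Z: "Z \<in> SM_level k"
    and x: "x \<in> carrier_vec n" "x' \<in> carrier_vec n" and z: "z \<in> carrier_vec k" "z' \<in> carrier_vec k"
  shows "(x @\<^sub>v z) \<bullet> (block_tuple X b Z i *\<^sub>v (x' @\<^sub>v z')) =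
    x \<bullet> (X i *\<^sub>v x') + x \<bullet> (b i *\<^sub>v z') + (b i *\<^sub>v z) \<bullet> x' + z \<bullet> (Z i *\<^sub>v z')"
proof -
  have c: "X i \<in> carrier_mat n n" "(b i)\<^sup>T \<in> carrier_mat k n" "Z i \<in> carrier_mat k k"
    using SM_level_carrier[OF X] SM_level_carrier[OF Z] b by auto
  have v: "X i *\<^sub>v x' \<in> carrier_vec n" "b i *\<^sub>v z' \<in> carrier_vec n"
      "(b i)\<^sup>T *\<^sub>v x' \<in> carrier_vec k" "Z i *\<^sub>v z' \<in> carrier_vec k"
    using c x z mult_mat_vec_carrier[OF b z(2), of i] mult_mat_vec_carrier[OF c(2) x(2)] by auto
  have "(x @\<^sub>v z) \<bullet> (block_tuple X b Z i *\<^sub>v (x' @\<^sub>v z')) =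
      x \<bullet> (X i *\<^sub>v x' + b i *\<^sub>v z') + z \<bullet> ((b i)\<^sup>T *\<^sub>v x' + Z i *\<^sub>v z')"
    unfolding block_tuple_def four_block_mat_mult_vec[OF c(1) b c(2,3) x(2) z(2)]
    using x z v by (intro scalar_prod_append) auto
  also have "\<dots> = x \<bullet> (X i *\<^sub>v x') + x \<bullet> (b i *\<^sub>v z') + (z \<bullet> ((b i)\<^sup>T *\<^sub>v x') + z \<bullet> (Z i *\<^sub>v z'))"
    using x z v by (simp add: scalar_prod_add_distrib[of _ n] scalar_prod_add_distrib[of _ k])
  also have "z \<bullet> ((b i)\<^sup>T *\<^sub>v x') = (b i *\<^sub>v z) \<bullet> x'"
    using scalar_prod_adjoint[OF b z(1) x(2)] by simp
  finally show ?thesis by simp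
qed

lemma zero_mult_mat_vec:
  "v \<in> carrier_vec k \<Longrightarrow> 0\<^sub>m n k *\<^sub>v v = (0\<^sub>v n :: real vec)"
  by (intro eq_vecI) auto

lemma direct_sum_scalar_prod:
  assumes X: "X \<in> SM_level n" and Z: "Z \<in> SM_level k"
    and x: "x \<in> carrier_vec n" "x' \<in> carrier_vec n" and z: "z \<in> carrier_vec k" "z' \<in> carrier_vec k"
  shows "(x @\<^sub>v z) \<bullet> (direct_sum X Z i *\<^sub>v (x' @\<^sub>v z')) = x \<bullet> (X i *\<^sub>v x') + z \<bullet> (Z i *\<^sub>v z')"
proof -
  show ?thesis
    unfolding direct_sum_eq_block_tuple[OF X Z]
    by (subst block_tuple_scalar_prod[OF X _ Z x z]) (use x z in \<open>auto simp: zero_mult_mat_vec\<close>)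
qed

lemma direct_sum_SM_level:
  assumes "X \<in> SM_level n" "Z \<in> SM_level k"
  shows "direct_sum X Z \<in> SM_level (n + k)"
  unfolding direct_sum_eq_block_tuple[OF assms] using assms by (intro block_tuple_SM_level) auto

section \<open>Orthogonal equivalence and reducing subspaces\<close>

lemma orth_equivI:
  assumes X: "X \<in> SM_level n" and Y: "Y \<in> SM_level n" and U: "U \<in> carrier_mat n n" "U\<^sup>T * U = 1\<^sub>m n"
    and eq: "\<And>i x y. x \<in> carrier_vec n \<Longrightarrow> y \<in> carrier_vec n \<Longrightarrow>
      (U *\<^sub>v x) \<bullet> (X i *\<^sub>v (U *\<^sub>v y)) = x \<bullet> (Y i *\<^sub>v y)"
  shows "X \<sim>\<^sub>u Y"
proof -
  have "compress U X i = Y i" for i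
    by (rule eq_mat_by_scalar_prod[of _ n n])
      (use SM_level_carrier[OF compress_SM_level[OF X U(1)]] SM_level_carrier[OF Y] in
        \<open>auto simp: compress_scalar_prod[OF X U(1)] eq\<close>)
  then show ?thesis
    using SM_level_carrier[OF X] U unfolding orth_equiv_def by blast
qed

text \<open>In full dimension the orthogonal complement has no columns and drops out of the
  resolution of the identity.\<close>

lemma square_isometry:
  fixes U :: "real mat"
  assumes U: "U \<in> carrier_mat n n" "U\<^sup>T * U = 1\<^sub>m n"
  shows "U * U\<^sup>T = 1\<^sub>m n"
proof -
  obtain k R where R: "n = n + k" "R \<in> carrier_mat n k" "U * U\<^sup>T + R * R\<^sup>T = 1\<^sub>m n"
    using isometry_complement[OF U] by metis
  then have "R * R\<^sup>T = 0\<^sub>m n n"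
    by (intro eq_matI) (auto simp: scalar_prod_def)
  then show ?thesis
    using R(3) right_add_zero_mat[of "U * U\<^sup>T" n n] U(1) by simp
qed

lemma orth_equivE:
  assumes "X \<sim>\<^sub>u Y" and X: "X \<in> SM_level n"
  obtains U where "U \<in> carrier_mat n n" "U\<^sup>T * U = 1\<^sub>m n" "U * U\<^sup>T = 1\<^sub>m n" "compress U X = Y"
proof -
  obtain m U where U: "\<forall>i. X i \<in> carrier_mat m m" "U \<in> carrier_mat m m"
    "U\<^sup>T * U = 1\<^sub>m m" "compress U X = Y"
    using assms(1) by (auto simp: orth_equiv_def)
  then have "m = n" using SM_level_carrier[OF X] by (metis carrier_matD(1))
  then show ?thesis
    using that U square_isometry by blast
qed

text \<open>By hypothesis the \<open>Y i\<close> leave the orthogonal complement of the range of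
  \<open>P\<close> invariant; being symmetric, they leave the range invariant too, so
  \<open>Y\<close> splits. A complement of size zero is sent to the first alternative because tuples
  of a free spectrahedron have positive size.\<close>

lemma isometry_reducing_direct_sum:
  assumes Y: "Y \<in> SM_level N" and P: "P \<in> carrier_mat N n" "P\<^sup>T * P = 1\<^sub>m n"
    and red: "\<And>i q. q \<in> carrier_vec N \<Longrightarrow> P\<^sup>T *\<^sub>v q = 0\<^sub>v n \<Longrightarrow> P\<^sup>T *\<^sub>v (Y i *\<^sub>v q) = 0\<^sub>v n"
  shows "(N = n \<and> compress P Y \<sim>\<^sub>u Y) \<or>
    (n < N \<and> (\<exists>k\<ge>1. \<exists>R\<in>carrier_mat N k. R\<^sup>T * R = 1\<^sub>m k \<and> direct_sum (compress P Y) (compress R Y) \<sim>\<^sub>u Y))"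
proof -
  obtain k R where N: "N = n + k" and R: "R \<in> carrier_mat N k" "R\<^sup>T * R = 1\<^sub>m k"
    and PR: "P\<^sup>T * R = 0\<^sub>m n k" and sum: "P * P\<^sup>T + R * R\<^sup>T = 1\<^sub>m N"
    using isometry_complement[OF P] by blast
  let ?X = "compress P Y" and ?Z = "compress R Y"
  have Yc: "Y i \<in> carrier_mat N N" for i by (rule SM_level_carrier[OF Y])
  have XZ: "?X \<in> SM_level n" "?Z \<in> SM_level k"
    using compress_SM_level[OF Y] P R by auto
  have PT: "P\<^sup>T \<in> carrier_mat n N" and RT: "R\<^sup>T \<in> carrier_mat k N" using P R by auto
  have PTv: "P\<^sup>T *\<^sub>v x \<in> carrier_vec n" and RTv: "R\<^sup>T *\<^sub>v x \<in> carrier_vec k" if "x \<in> carrier_vec N" for x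
    using PT RT that by auto
  have Pv: "P *\<^sub>v a \<in> carrier_vec N" if "a \<in> carrier_vec n" for a using P that by auto
  have Rv: "R *\<^sub>v a \<in> carrier_vec N" if "a \<in> carrier_vec k" for a using R that by auto
  have decomp: "P *\<^sub>v (P\<^sup>T *\<^sub>v x) + R *\<^sub>v (R\<^sup>T *\<^sub>v x) = x" if x: "x \<in> carrier_vec N" for x
  proof -
    have "(P * P\<^sup>T + R * R\<^sup>T) *\<^sub>v x = (P * P\<^sup>T) *\<^sub>v x + (R * R\<^sup>T) *\<^sub>v x"
      by (rule add_mult_distrib_mat_vec[of _ N N]) (use P R x in auto)
    then show ?thesis
      using sum x by (simp add: assoc_mult_mat_vec[OF P(1) PT x] assoc_mult_mat_vec[OF R(1) RT x])
  qed
  have cross: "(P *\<^sub>v a) \<bullet> (Y i *\<^sub>v (R *\<^sub>v b)) = 0" if a: "a \<in> carrier_vec n" and b: "b \<in> carrier_vec k" for a b i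
  proof -
    have "P\<^sup>T *\<^sub>v (R *\<^sub>v b) = 0\<^sub>v n"
      using PR b assoc_mult_mat_vec[OF PT R(1) b] by (simp add: zero_mult_mat_vec)
    then have "P\<^sup>T *\<^sub>v (Y i *\<^sub>v (R *\<^sub>v b)) = 0\<^sub>v n"
      using red Rv b by blast
    then show ?thesis
      using scalar_prod_adjoint[OF P(1) a, of "Y i *\<^sub>v (R *\<^sub>v b)"] Yc[of i] Rv b a by simp
  qed
  have form: "x \<bullet> (Y i *\<^sub>v y) = (P\<^sup>T *\<^sub>v x) \<bullet> (?X i *\<^sub>v (P\<^sup>T *\<^sub>v y)) + (R\<^sup>T *\<^sub>v x) \<bullet> (?Z i *\<^sub>v (R\<^sup>T *\<^sub>v y))"
    if x: "x \<in> carrier_vec N" and y: "y \<in> carrier_vec N" for x y i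
  proof -
    let ?x1 = "P *\<^sub>v (P\<^sup>T *\<^sub>v x)" and ?x2 = "R *\<^sub>v (R\<^sup>T *\<^sub>v x)"
      and ?y1 = "P *\<^sub>v (P\<^sup>T *\<^sub>v y)" and ?y2 = "R *\<^sub>v (R\<^sup>T *\<^sub>v y)"
    have v: "?x1 \<in> carrier_vec N" "?x2 \<in> carrier_vec N" "?y1 \<in> carrier_vec N" "?y2 \<in> carrier_vec N"
      using Pv Rv PTv RTv x y by auto
    then have Yv: "Y i *\<^sub>v ?y1 \<in> carrier_vec N" "Y i *\<^sub>v ?y2 \<in> carrier_vec N"
      using Yc[of i] by auto
    have c: "?x2 \<bullet> (Y i *\<^sub>v ?y1) = 0"
      using symmetric_scalar_prod[OF Yc SM_level_sym[OF Y] v(2,3)] cross PTv RTv x y by simp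
    have "x \<bullet> (Y i *\<^sub>v y) = (?x1 + ?x2) \<bullet> (Y i *\<^sub>v (?y1 + ?y2))"
      by (simp add: decomp x y)
    also have "\<dots> = ?x1 \<bullet> (Y i *\<^sub>v ?y1) + ?x2 \<bullet> (Y i *\<^sub>v ?y2)"
      using v Yv c cross[OF PTv[OF x] RTv[OF y]]
      by (simp add: mult_add_distrib_mat_vec[OF Yc] add_scalar_prod_distrib[of _ N]
          scalar_prod_add_distrib[of _ N])
    finally show ?thesis
      by (simp add: compress_scalar_prod[OF Y P(1) PTv PTv] compress_scalar_prod[OF Y R(1) RTv RTv] x y)
  qed
  show ?thesis
  proof (cases "k = 0")
    case True
    have Z0: "u \<bullet> (?Z i *\<^sub>v v) = 0" for u v i
      using SM_level_carrier[OF XZ(2), of i] True by (simp add: scalar_prod_def)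
    have "R * R\<^sup>T = 0\<^sub>m N N" using R True by (intro eq_matI) (auto simp: scalar_prod_def)
    then have "P * P\<^sup>T = 1\<^sub>m N" using sum P right_add_zero_mat[of "P * P\<^sup>T" N N] by simp
    then have "?X \<sim>\<^sub>u Y"
      using True N XZ Y PT P form
      by (intro orth_equivI[of _ N _ "P\<^sup>T"]) (simp_all add: Z0)
    then show ?thesis using True N by simp
  next
    case False
    \<comment> \<open>Stacking \<open>P\<^sup>T\<close> on \<open>R\<^sup>T\<close> gives the
      coordinates of a vector in the two reducing subspaces.\<close>
    let ?U = "P\<^sup>T @\<^sub>r R\<^sup>T"
    have U: "?U \<in> carrier_mat N N" using PT RT N by auto
    have Uv: "?U *\<^sub>v x = (P\<^sup>T *\<^sub>v x) @\<^sub>v (R\<^sup>T *\<^sub>v x)" if "x \<in> carrier_vec N" for x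
      by (rule mat_mult_append[OF PT RT that])
    have "x \<bullet> (?U\<^sup>T * ?U *\<^sub>v y) = x \<bullet> (1\<^sub>m N *\<^sub>v y)" if x: "x \<in> carrier_vec N" and y: "y \<in> carrier_vec N" for x y
    proof -
      have "x \<bullet> (?U\<^sup>T * ?U *\<^sub>v y) = (?U *\<^sub>v x) \<bullet> (?U *\<^sub>v y)"
        using U x y by (simp add: scalar_prod_adjoint[OF U x] assoc_mult_mat_vec[of _ N N _ N])
      also have "\<dots> = (P\<^sup>T *\<^sub>v x) \<bullet> (P\<^sup>T *\<^sub>v y) + (R\<^sup>T *\<^sub>v x) \<bullet> (R\<^sup>T *\<^sub>v y)"
        unfolding Uv[OF x] Uv[OF y] by (rule scalar_prod_append[OF PTv[OF x] RTv[OF x] PTv[OF y] RTv[OF y]])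
      also have "\<dots> = x \<bullet> (P *\<^sub>v (P\<^sup>T *\<^sub>v y)) + x \<bullet> (R *\<^sub>v (R\<^sup>T *\<^sub>v y))"
        using scalar_prod_adjoint[OF PT x PTv[OF y]] scalar_prod_adjoint[OF RT x RTv[OF y]] by simp
      also have "\<dots> = x \<bullet> (P *\<^sub>v (P\<^sup>T *\<^sub>v y) + R *\<^sub>v (R\<^sup>T *\<^sub>v y))"
        by (rule scalar_prod_add_distrib[symmetric, OF x Pv[OF PTv[OF y]] Rv[OF RTv[OF y]]])
      finally show ?thesis using y by (simp add: decomp)
    qed
    then have UU: "?U\<^sup>T * ?U = 1\<^sub>m N"
      using U by (intro eq_mat_by_scalar_prod[of _ N N]) auto
    have "direct_sum ?X ?Z \<sim>\<^sub>u Y"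
    proof (rule orth_equivI[OF _ Y U UU])
      show "direct_sum ?X ?Z \<in> SM_level N" using direct_sum_SM_level[OF XZ] N by simp
    qed (simp add: Uv direct_sum_scalar_prod[OF XZ] PTv RTv form)
    moreover have "n < N" "1 \<le> k" using False N by auto
    ultimately show ?thesis using R by blast
  qed
qed

section \<open>Traces under orthogonal equivalence\<close>

lemma mat_trace_four_block:
  assumes "A \<in> carrier_mat n n" "D \<in> carrier_mat k k"
  shows "mat_trace (four_block_mat A B C D) = mat_trace A + mat_trace D"
proof -
  have "(\<Sum>i<n + k. four_block_mat A B C D $$ (i, i)) =
      (\<Sum>i<n. four_block_mat A B C D $$ (i, i)) + (\<Sum>i<k. four_block_mat A B C D $$ (n + i, n + i))"
    by (induction k) (auto simp: algebra_simps)
  then show ?thesis using assms by (simp add: mat_trace_def)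
qed

lemma mat_trace_conjugate:
  assumes "U \<in> carrier_mat n n" "U * U\<^sup>T = 1\<^sub>m n" "M \<in> carrier_mat n n"
  shows "mat_trace (U\<^sup>T * M * U) = mat_trace M"
proof -
  have "mat_trace (U\<^sup>T * M * U) = mat_trace (U * (U\<^sup>T * M))"
    using assms by (intro mat_trace_mult_commute[of _ n n]) auto
  also have "U * (U\<^sup>T * M) = U * U\<^sup>T * M"
    using assms by (intro assoc_mult_mat[symmetric]) auto
  finally show ?thesis using assms by simp
qed

lemma mat_trace_mult_transpose:
  assumes "b \<in> carrier_mat n k"
  shows "mat_trace (b * b\<^sup>T) = (\<Sum>r<n. \<Sum>s<k. (b $$ (r, s))\<^sup>2)"
  using assms by (simp add: mat_trace_def scalar_prod_def lessThan_atLeast0 power2_eq_square)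

text \<open>Equality of traces identifies the corners; then equality of the traces of the squares kills b.\<close>

lemma orth_equiv_block_tuple:
  assumes X: "X \<in> SM_level n" and b: "\<And>i. b i \<in> carrier_mat n 1" and Y: "Y \<in> SM_level 1"
    and Z: "Z \<in> SM_level k" and equiv: "direct_sum X Z \<sim>\<^sub>u block_tuple X b Y"
  shows "b i = 0\<^sub>m n 1"
proof -
  let ?S = "direct_sum X Z" and ?T = "block_tuple X b Y"
  obtain U where U: "U \<in> carrier_mat (n + k) (n + k)" "U * U\<^sup>T = 1\<^sub>m (n + k)" "compress U ?S = ?T"
    using orth_equivE[OF equiv direct_sum_SM_level[OF X Z]] by metis
  have Tc: "?T \<in> SM_level (n + k)"
    using compress_SM_level[OF direct_sum_SM_level[OF X Z] U(1)] U(3) by simp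
  \<comment> \<open>Equality of sizes makes the second summand a tuple of numbers, each determined
    by its trace.\<close>
  then have k: "k = 1"
    using SM_level_unique[OF Tc block_tuple_SM_level[where b = b, OF X b Y]] by simp
  have S: "?S i \<in> carrier_mat (n + k) (n + k)"
    using SM_level_carrier[OF direct_sum_SM_level[OF X Z]] .
  have Ti: "U\<^sup>T * ?S i * U = ?T i" using U(3) by (auto simp: compress_def fun_eq_iff)
  have "mat_trace (?T i * ?T i) = mat_trace (U\<^sup>T * (?S i * ?S i) * U)"
  proof -
    have "?T i * ?T i = U\<^sup>T * ?S i * (U * U\<^sup>T) * (?S i * U)"
      unfolding Ti[symmetric] using U(1) S
      by (simp add: assoc_mult_mat[of _ "n + k" "n + k" _ "n + k" _ "n + k"])
    also have "\<dots> = U\<^sup>T * (?S i * ?S i) * U"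
      unfolding U(2) using U(1) S
      by (simp add: assoc_mult_mat[of _ "n + k" "n + k" _ "n + k" _ "n + k"])
    finally show ?thesis by simp
  qed
  also have "\<dots> = mat_trace (?S i * ?S i)"
    using U S by (intro mat_trace_conjugate[of _ "n + k"]) auto
  finally have tr2: "mat_trace (?T i * ?T i) = mat_trace (?S i * ?S i)" .
  have tr1: "mat_trace (?T i) = mat_trace (?S i)"
    using mat_trace_conjugate[OF U(1,2) S] Ti by simp
  have c: "X i \<in> carrier_mat n n" "Y i \<in> carrier_mat 1 1" "Z i \<in> carrier_mat 1 1" "b i \<in> carrier_mat n 1"
    "(b i)\<^sup>T \<in> carrier_mat 1 n"
    using SM_level_carrier[OF X] SM_level_carrier[OF Y] SM_level_carrier[OF Z] b k by auto
  have Si: "?S i = four_block_mat (X i) (0\<^sub>m n 1) (0\<^sub>m 1 n) (Z i)"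
    by (simp add: direct_sum_eq_block_tuple[OF X Z] block_tuple_def k)
  have one: "mat_trace M = M $$ (0, 0)" "mat_trace (M * M) = (M $$ (0, 0))\<^sup>2"
    if "M \<in> carrier_mat 1 1" for M
    using that by (simp_all add: mat_trace_def scalar_prod_def power2_eq_square)
  have YZ: "Y i $$ (0, 0) = Z i $$ (0, 0)"
    using tr1 c by (simp add: Si block_tuple_def mat_trace_four_block[of _ n _ 1] one)
  have "mat_trace (?T i * ?T i) = mat_trace (X i * X i + b i * (b i)\<^sup>T) + mat_trace ((b i)\<^sup>T * b i + Y i * Y i)"
    unfolding block_tuple_def mult_four_block_mat[OF c(1,4,5,2) c(1,4,5,2)]
    using c by (intro mat_trace_four_block) auto
  also have "\<dots> = mat_trace (X i * X i) + 2 * mat_trace (b i * (b i)\<^sup>T) + mat_trace (Y i * Y i)"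
    using mat_trace_mult_commute[OF c(4,5)] c by (simp add: mat_trace_def sum.distrib)
  finally have T2: "mat_trace (?T i * ?T i) = \<dots>" .
  have "mat_trace (?S i * ?S i) =
      mat_trace (X i * X i + 0\<^sub>m n 1 * 0\<^sub>m 1 n) + mat_trace (0\<^sub>m 1 n * 0\<^sub>m n 1 + Z i * Z i)"
    unfolding Si
    by (subst mult_four_block_mat[OF c(1) _ _ c(3) c(1) _ _ c(3)], use c in simp_all,
        intro mat_trace_four_block) (use c in auto)
  also have "\<dots> = mat_trace (X i * X i) + mat_trace (Z i * Z i)"
    using c by (simp add: mat_trace_def sum.distrib)
  also have "mat_trace (Z i * Z i) = mat_trace (Y i * Y i)"
    by (simp only: one(2)[OF c(2)] one(2)[OF c(3)] YZ)
  finally have "mat_trace (b i * (b i)\<^sup>T) = 0"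
    using T2 tr2 by linarith
  then have "(b i $$ (r, s))\<^sup>2 = 0" if "r < n" "s < 1" for r s
    using that unfolding mat_trace_mult_transpose[OF c(4)]
    by (simp add: sum_nonneg_eq_0_iff)
  then show ?thesis
    using c by (intro eq_matI) auto
qed

lemma compress_compress:
  assumes Y: "Y \<in> SM_level N" and V: "V \<in> carrier_mat N n" and W: "W \<in> carrier_mat n k"
  shows "compress W (compress V Y) = compress (V * W) Y"
proof
  fix i
  have VY: "compress V Y \<in> SM_level n" by (rule compress_SM_level[OF Y V])
  have VW: "V * W \<in> carrier_mat N k" using V W by simp
  show "compress W (compress V Y) i = compress (V * W) Y i"
  proof (rule eq_mat_by_scalar_prod[of _ k k])
    fix x y :: "real vec" assume xy: "x \<in> carrier_vec k" "y \<in> carrier_vec k"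
    then have "W *\<^sub>v x \<in> carrier_vec n" "W *\<^sub>v y \<in> carrier_vec n" using W by auto
    then show "x \<bullet> (compress W (compress V Y) i *\<^sub>v y) = x \<bullet> (compress (V * W) Y i *\<^sub>v y)"
      by (simp add: compress_scalar_prod[OF VY W xy] compress_scalar_prod[OF Y V]
          compress_scalar_prod[OF Y VW xy] assoc_mult_mat_vec[OF V W] xy)
  qed (use SM_level_carrier[OF compress_SM_level[OF VY W]] SM_level_carrier[OF compress_SM_level[OF Y VW]] in auto)
qed

lemma compress_one:
  assumes "X \<in> SM_level n"
  shows "compress (1\<^sub>m n) X = X"
proof
  fix i
  show "compress (1\<^sub>m n) X i = X i"
    using SM_level_carrier[OF assms, of i]
    by (simp add: compress_def left_mult_one_mat[of _ n n] right_mult_one_mat[of _ n n])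
qed

section \<open>Free extreme points and faces\<close>

text \<open>Presents a dilation as a combination with one term, so that extremality can be applied
  to it.\<close>

lemma mat_conv_comb_single:
  assumes Y: "Y \<in> level K N" and J: "J \<in> carrier_mat N n" "J\<^sup>T * J = 1\<^sub>m n"
  shows "mat_conv_comb K n 1 (\<lambda>_. N) (\<lambda>_. J) (\<lambda>_. Y) (compress J Y)"
proof -
  have "mat_sum n (\<lambda>_. M) {..<1::nat} = M" if "M \<in> carrier_mat n n" for M
    using that by (auto simp: mat_sum_def)
  moreover have "compress J Y i \<in> carrier_mat n n" for i
    using Y J by (auto simp: level_def intro: SM_level_carrier compress_SM_level)
  ultimately show ?thesis
    using assms by (simp add: mat_conv_comb_def)
qed

lemma free_extreme_pointI:
  assumes "1 \<le> n" "X \<in> level K n"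
    and "\<And>m N V Y l. mat_conv_comb K n m N V Y X \<Longrightarrow> \<forall>l<m. V l \<noteq> 0\<^sub>m (N l) n \<Longrightarrow> l < m \<Longrightarrow>
      (N l = n \<and> X \<sim>\<^sub>u Y l) \<or> (N l > n \<and> (\<exists>Z\<in>K. direct_sum X Z \<sim>\<^sub>u Y l))"
  shows "free_extreme_point K X"
  unfolding free_extreme_point_def using assms by blast

lemma free_extreme_pointD:
  assumes "free_extreme_point K X" "X \<in> SM_level n" "mat_conv_comb K n m N V Y X"
    "\<And>l. l < m \<Longrightarrow> V l \<noteq> 0\<^sub>m (N l) n" "l < m"
  shows "(N l = n \<and> X \<sim>\<^sub>u Y l) \<or> (N l > n \<and> (\<exists>Z\<in>K. direct_sum X Z \<sim>\<^sub>u Y l))"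
proof -
  obtain n' where n': "X \<in> level K n'"
    "\<forall>m N V Y. mat_conv_comb K n' m N V Y X \<and> (\<forall>l<m. V l \<noteq> 0\<^sub>m (N l) n') \<longrightarrow>
        (\<forall>l<m. (N l = n' \<and> X \<sim>\<^sub>u Y l) \<or> (N l > n' \<and> (\<exists>Z\<in>K. direct_sum X Z \<sim>\<^sub>u Y l)))"
    using assms(1) unfolding free_extreme_point_def by blast
  have "n' = n" using n'(1) assms(2) SM_level_unique by (auto simp: level_def)
  then show ?thesis using n'(2) assms(3-) by blast
qed

lemma face_of_convex_pair:
  assumes F: "F face_of C" and ab: "a \<in> C" "b \<in> C" and t: "0 < t" "t \<le> (1::real)"
    and mem: "t *\<^sub>R a + (1 - t) *\<^sub>R b \<in> F"
  shows "a \<in> F"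
proof (cases "a = b \<or> t = 1")
  case True
  then show ?thesis using mem by (auto simp flip: scaleR_add_left)
next
  case False
  then have "t *\<^sub>R a + (1 - t) *\<^sub>R b \<in> open_segment a b"
    using t unfolding in_segment by (intro conjI exI[of _ "1 - t"]) auto
  then show ?thesis using face_ofD[OF F] ab mem by blast
qed

section \<open>A face of level one and dilations of points of its lift\<close>

context
  fixes d :: nat and A :: "'h::finite \<Rightarrow> real mat" and F :: "(real ^ 'h) set"
  assumes A: "A \<in> SM_level d"
    and face: "F face_of level_one (free_spectrahedron d A)"
begin

lemma face_eq: "F = affine hull F \<inter> level_one (free_spectrahedron d A)"
  by (rule face_of_imp_eq_affine_Int[OF convex_level_one[OF A] face])

lemma numval_level_one_multiple:
  assumes "Y \<in> SM_level n" "Y \<in> free_spectrahedron d A" "x \<in> carrier_vec n" "x \<noteq> 0\<^sub>v n"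
  obtains c where "c \<in> level_one (free_spectrahedron d A)" "numval Y x = (x \<bullet> x) *\<^sub>R c"
proof -
  obtain e where e: "e \<in> carrier_vec n" "e \<bullet> e = 1" "x = sqrt (x \<bullet> x) \<cdot>\<^sub>v e" "0 < x \<bullet> x"
    using unit_multiple[OF assms(3,4)] by blast
  have "numval Y x = (sqrt (x \<bullet> x))\<^sup>2 *\<^sub>R numval Y e"
    using e(3) numval_smult[OF assms(1) e(1)] by metis
  then show ?thesis
    using that numval_level_one[OF A assms(1,2) e(1,2)] e(4) by simp
qed

lemma numval_face_multiple:
  assumes "X \<in> SM_level n" "X \<in> graded_lift (free_spectrahedron d A) F" "x \<in> carrier_vec n" "x \<noteq> 0\<^sub>v n"
  obtains f where "f \<in> F" "numval X x = (x \<bullet> x) *\<^sub>R f"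
proof -
  obtain e where e: "e \<in> carrier_vec n" "e \<bullet> e = 1" "x = sqrt (x \<bullet> x) \<cdot>\<^sub>v e" "0 < x \<bullet> x"
    using unit_multiple[OF assms(3,4)] by blast
  have "numval X x = (sqrt (x \<bullet> x))\<^sup>2 *\<^sub>R numval X e"
    using e(3) numval_smult[OF assms(1) e(1)] by metis
  moreover have "numval X e \<in> F"
    using face_eq numval_level_one[OF A assms(1) _ e(1,2)] aff_mat_numval[OF _ assms(1) e(1,2)] assms(2)
    by (auto simp: graded_lift_def)
  ultimately show ?thesis
    using that e(4) by simp
qed

text \<open>The vector \<open>v\<close> is scaled so that summand \<open>l\<close> has weight 1. If
  the other weights add up to \<open>r\<close>, then \<open>(1 + r) f = c l + r z\<close> with
  \<open>f\<close> in \<open>F\<close> and \<open>z\<close> in level one, and the face property puts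
  \<open>c l\<close> into \<open>F\<close>.\<close>

lemma numval_summand_mem_face:
  assumes comb: "mat_conv_comb (free_spectrahedron d A) n m N V Y X"
    and X: "X \<in> graded_lift (free_spectrahedron d A) F"
    and l: "l < m" and v: "v \<in> carrier_vec n" and unit: "(V l *\<^sub>v v) \<bullet> (V l *\<^sub>v v) = 1"
  shows "numval (Y l) (V l *\<^sub>v v) \<in> F"
proof -
  let ?C = "level_one (free_spectrahedron d A)"
  let ?u = "\<lambda>l. V l *\<^sub>v v" and ?I = "{..<m} - {l}"
  have Xn: "X \<in> SM_level n" by (rule mat_conv_comb_SM_level[OF comb])
  have Y: "Y l \<in> SM_level (N l)" "Y l \<in> free_spectrahedron d A" and V: "V l \<in> carrier_mat (N l) n"
    if "l < m" for l
    using comb that by (auto simp: mat_conv_comb_def level_def)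
  have u: "?u l \<in> carrier_vec (N l)" if "l < m" for l
    using V[OF that] v by simp
  have "\<exists>c\<in>?C. numval (Y j) (?u j) = (?u j \<bullet> ?u j) *\<^sub>R c" if j: "j < m" for j
  proof (cases "?u j = 0\<^sub>v (N j)")
    \<comment> \<open>A point of weight zero may be chosen freely; the value of summand
      \<open>l\<close> shows that level one has a point.\<close>
    case True
    have "numval (Y l) (?u l) \<in> ?C" by (rule numval_level_one[OF A Y[OF l] u[OF l] unit])
    then show ?thesis using True numval_zero[OF Y(1)[OF j]] by auto
  qed (use numval_level_one_multiple[OF Y[OF j] u[OF j]] in blast)
  then obtain c where c: "\<And>j. j < m \<Longrightarrow> c j \<in> ?C"
      "\<And>j. j < m \<Longrightarrow> numval (Y j) (?u j) = (?u j \<bullet> ?u j) *\<^sub>R c j"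
    by metis
  define r where "r = (\<Sum>j\<in>?I. ?u j \<bullet> ?u j)"
  have r: "0 \<le> r" unfolding r_def by (intro sum_nonneg scalar_prod_self_nonneg)
  have vv: "v \<bullet> v = 1 + r"
    unfolding mat_conv_comb_unit[OF comb v] r_def using l unit
    by (simp add: sum.remove[of "{..<m}" l])
  have "v \<noteq> 0\<^sub>v n" using vv r scalar_prod_self_eq_0_iff[OF v] by auto
  then obtain f where f: "f \<in> F" "numval X v = (v \<bullet> v) *\<^sub>R f"
    using numval_face_multiple[OF Xn X v] by blast
  have split: "(1 + r) *\<^sub>R f = c l + (\<Sum>j\<in>?I. (?u j \<bullet> ?u j) *\<^sub>R c j)"
  proof -
    have "(1 + r) *\<^sub>R f = (\<Sum>j<m. (?u j \<bullet> ?u j) *\<^sub>R c j)"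
      using f(2) c(2) unfolding mat_conv_comb_numval[OF comb v] vv by simp
    then show ?thesis using l unit by (simp add: sum.remove[of "{..<m}" l])
  qed
  obtain z where z: "z \<in> ?C" "(\<Sum>j\<in>?I. (?u j \<bullet> ?u j) *\<^sub>R c j) = r *\<^sub>R z"
  proof (cases "r = 0")
    case True
    then have "?u j \<bullet> ?u j = 0" if "j \<in> ?I" for j
      using that unfolding r_def by (subst (asm) sum_nonneg_eq_0_iff) (auto simp: scalar_prod_self_nonneg)
    then show ?thesis using that[of "c l"] c(1)[OF l] True by simp
  next
    case False
    have "(\<Sum>j\<in>?I. ((?u j \<bullet> ?u j) / r) *\<^sub>R c j) \<in> ?C"
      using c(1) r False
      by (intro convex_sum[OF _ convex_level_one[OF A]])
        (auto simp: r_def scalar_prod_self_nonneg simp flip: sum_divide_distrib)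
    moreover have "(\<Sum>j\<in>?I. (?u j \<bullet> ?u j) *\<^sub>R c j) = r *\<^sub>R (\<Sum>j\<in>?I. ((?u j \<bullet> ?u j) / r) *\<^sub>R c j)"
      using False by (simp add: scaleR_sum_right)
    ultimately show ?thesis using that by blast
  qed
  have "f = (1 / (1 + r)) *\<^sub>R ((1 + r) *\<^sub>R f)" using r by simp
  also have "\<dots> = (1 / (1 + r)) *\<^sub>R c l + (r / (1 + r)) *\<^sub>R z"
    unfolding split z(2) by (simp add: scaleR_add_right)
  also have "r / (1 + r) = 1 - 1 / (1 + r)" using r by (simp add: field_simps)
  finally have "(1 / (1 + r)) *\<^sub>R c l + (1 - 1 / (1 + r)) *\<^sub>R z \<in> F" using f(1) by simp
  then have "c l \<in> F"
    using r by (intro face_of_convex_pair[OF face c(1)[OF l] z(1)]) auto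
  then show ?thesis using c(2)[OF l] unit by simp
qed

text \<open>A unit vector \<open>x\<close> is sent by \<open>P = V l * S\<close> to the unit vector
  \<open>V l v\<close> with \<open>v = S x\<close>, so \<open>numval_summand_mem_face\<close> covers
  every value of the compression.\<close>

lemma compress_range_mem_graded_lift:
  assumes comb: "mat_conv_comb (free_spectrahedron d A) n m N V Y X"
    and X: "X \<in> graded_lift (free_spectrahedron d A) F"
    and l: "l < m" and P: "P = V l * S" "S \<in> carrier_mat n k" "P\<^sup>T * P = 1\<^sub>m k" and k: "1 \<le> k"
  shows "compress P (Y l) \<in> level (graded_lift (free_spectrahedron d A) F) k"
proof -
  have Y: "Y l \<in> SM_level (N l)" "Y l \<in> free_spectrahedron d A" and V: "V l \<in> carrier_mat (N l) n"
    using comb l by (auto simp: mat_conv_comb_def level_def)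
  have Pc: "P \<in> carrier_mat (N l) k" using V P by simp
  have S: "compress P (Y l) \<in> SM_level k" by (rule compress_SM_level[OF Y(1) Pc])
  have "numval (compress P (Y l)) x \<in> affine hull F" if x: "x \<in> carrier_vec k" "x \<bullet> x = 1" for x
  proof -
    have Px: "P *\<^sub>v x = V l *\<^sub>v (S *\<^sub>v x)"
      unfolding P(1) by (rule assoc_mult_mat_vec[OF V P(2) x(1)])
    have "numval (Y l) (P *\<^sub>v x) \<in> F"
      unfolding Px using isometry_scalar_prod[OF Pc P(3) x(1) x(1)] x P(2)
      by (intro numval_summand_mem_face[OF comb X l]) (auto simp: Px)
    then show ?thesis
      using hull_subset[of F affine] by (auto simp: numval_compress[OF Y(1) Pc x(1)])
  qed
  then show ?thesis
    using aff_matI_numval[OF S k] free_spectrahedron_compress[OF A Y Pc P(3) k] S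
    by (auto simp: level_def graded_lift_def)
qed

text \<open>For fixed \<open>u\<close> the form is affine in the point and nonnegative on
  \<open>F\<close>. The segment from \<open>f\<close> to \<gamma> can be prolonged beyond \<gamma>
  inside \<open>F\<close>, so a zero at \<gamma> excludes a positive value at
  \<open>f\<close>.\<close>

lemma scalar_pencil_form_kernel_face:
  assumes \<gamma>: "\<gamma> \<in> rel_interior F" and f: "f \<in> F" and u: "scalar_pencil_form d A \<gamma> u u = 0"
  shows "scalar_pencil_form d A f u u = 0"
proof -
  have sub: "F \<subseteq> level_one (free_spectrahedron d A)" by (rule face_of_imp_subset[OF face])
  have "convex F" by (rule face_of_imp_convex[OF face])
  then obtain e where e: "e > 1" "(1 - e) *\<^sub>R f + e *\<^sub>R \<gamma> \<in> F"
    using \<gamma> f convex_rel_interior_iff[of F \<gamma>] by blast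
  then have "0 \<le> scalar_pencil_form d A ((1 - e) *\<^sub>R f + e *\<^sub>R \<gamma>) u u"
    using sub mem_level_one_iff[OF A] by blast
  then have "0 \<le> (1 - e) * scalar_pencil_form d A f u u"
    using u by (subst (asm) scalar_pencil_form_affine) auto
  then have "scalar_pencil_form d A f u u \<le> 0"
    using e by (simp add: zero_le_mult_iff)
  moreover have "0 \<le> scalar_pencil_form d A f u u"
    using sub f mem_level_one_iff[OF A] by blast
  ultimately show ?thesis by simp
qed

text \<open>The kernel condition lets \<gamma> move a little along \<open>v\<close> and along
  \<open>- v\<close> within level one. As \<gamma> is the midpoint of the two positions, the face
  contains them.\<close>

lemma face_direction:
  assumes \<gamma>: "\<gamma> \<in> F"
    and ker: "\<And>u c. scalar_pencil_form d A \<gamma> u u = 0 \<Longrightarrow> scalar_pencil_lin d A v c u = 0"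
  obtains \<epsilon> where "\<epsilon> > 0" "\<gamma> + \<epsilon> *\<^sub>R v \<in> F"
proof -
  let ?C = "level_one (free_spectrahedron d A)"
  have \<gamma>C: "\<gamma> \<in> ?C" using \<gamma> face_of_imp_subset[OF face] by blast
  then have "scalar_tuple \<gamma> \<in> free_spectrahedron d A" by (simp add: level_one_def)
  moreover have "pencil_lin d A (scalar_tuple v) w' w = 0"
    if "\<And>a. w a \<in> carrier_vec 1" "\<And>a. w' a \<in> carrier_vec 1" "pencil_form d A (scalar_tuple \<gamma>) w w = 0" for w w'
    using ker that by (simp add: pencil_form_scalar_tuple pencil_lin_scalar_tuple)
  ultimately obtain \<epsilon> where \<epsilon>: "\<epsilon> > 0"
    "\<And>t w. \<bar>t\<bar> \<le> \<epsilon> \<Longrightarrow> (\<And>a. w a \<in> carrier_vec 1) \<Longrightarrow>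
       0 \<le> pencil_form d A (scalar_tuple \<gamma>) w w - t * pencil_lin d A (scalar_tuple v) w w"
    using pencil_perturbation[OF A scalar_tuple_SM_level _ scalar_tuple_SM_level] by metis
  have mem: "\<gamma> + t *\<^sub>R v \<in> ?C" if "\<bar>t\<bar> \<le> \<epsilon>" for t
    unfolding mem_level_one_iff[OF A]
  proof
    fix u
    show "0 \<le> scalar_pencil_form d A (\<gamma> + t *\<^sub>R v) u u"
      using \<epsilon>(2)[OF that, of "\<lambda>a. vec 1 (\<lambda>_. u a)"]
      by (simp add: pencil_form_scalar_tuple pencil_lin_scalar_tuple scalar_pencil_form_def
          scalar_pencil_lin_linear)
  qed
  have "(1 / 2) *\<^sub>R (\<gamma> + \<epsilon> *\<^sub>R v) + (1 - 1 / 2) *\<^sub>R (\<gamma> + (- \<epsilon>) *\<^sub>R v) = \<gamma>"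
    by (simp add: Finite_Cartesian_Product.vec_eq_iff field_simps)
  then have "\<gamma> + \<epsilon> *\<^sub>R v \<in> F"
    using \<gamma> \<epsilon>(1) by (intro face_of_convex_pair[OF face mem mem, of \<epsilon> "- \<epsilon>" "1 / 2"]) auto
  then show ?thesis using that \<epsilon>(1) by blast
qed

text \<open>The conclusion is the reducing condition of \<open>isometry_reducing_direct_sum\<close>,
  for one vector \<open>q\<close> orthogonal to the range of \<open>P\<close>.\<close>

lemma dilation_trivial:
  assumes F: "F \<noteq> {}" and Y: "Y \<in> SM_level N" "Y \<in> free_spectrahedron d A"
    and P: "P \<in> carrier_mat N n" "P\<^sup>T * P = 1\<^sub>m n" and n: "1 \<le> n"
    and X: "compress P Y \<in> graded_lift (free_spectrahedron d A) F"
    and ext: "free_extreme_point (graded_lift (free_spectrahedron d A) F) (compress P Y)"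
    and q: "q \<in> carrier_vec N" "P\<^sup>T *\<^sub>v q = 0\<^sub>v n"
  shows "P\<^sup>T *\<^sub>v (Y i *\<^sub>v q) = 0\<^sub>v n"
proof -
  let ?K = "free_spectrahedron d A" and ?X = "compress P Y"
  have XS: "?X \<in> SM_level n" by (rule compress_SM_level[OF Y(1) P(1)])
  have XK: "?X \<in> ?K" using X by (simp add: graded_lift_def)
  have Yc: "Y i \<in> carrier_mat N N" for i by (rule SM_level_carrier[OF Y(1)])
  \<comment> \<open>The column of \<open>Y\<close> from \<open>q\<close> to the range of
    \<open>P\<close>, in the coordinates of \<open>compress P Y\<close>; the corner at
    \<open>q\<close> itself never enters.\<close>
  define \<beta> where "\<beta> i = P\<^sup>T *\<^sub>v (Y i *\<^sub>v q)" for i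
  have \<beta>: "\<beta> i \<in> carrier_vec n" for i
    unfolding \<beta>_def using P Yc[of i] q by (intro mult_mat_vec_carrier[of _ n N]) auto
  obtain \<gamma> where \<gamma>: "\<gamma> \<in> rel_interior F"
    using F face_of_imp_convex[OF face] rel_interior_eq_empty by blast
  then have \<gamma>F: "\<gamma> \<in> F" using rel_interior_subset by blast
  then have \<gamma>K: "\<forall>u. 0 \<le> scalar_pencil_form d A \<gamma> u u"
    using face_of_imp_subset[OF face] mem_level_one_iff[OF A] by blast

  have ker_X: "(\<Sum>i\<in>UNIV. \<Sum>b<d. A i $$ (a, b) * (\<beta> i \<bullet> w b)) = 0"
    if w: "\<And>a. w a \<in> carrier_vec n" "pencil_form d A ?X w w = 0" and a: "a < d" for w a
  proof -
    \<comment> \<open>With \<open>q\<close> in slot \<open>a\<close> alone, the pairing with the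
      null family reads off row \<open>a\<close>; the identity part of the pencil vanishes because
      \<open>q\<close> is orthogonal to the range of \<open>P\<close>.\<close>
    let ?w' = "\<lambda>a'. of_bool (a' = a) \<cdot>\<^sub>v q"
    have Pw: "P *\<^sub>v w b \<in> carrier_vec N" for b using P w(1) by simp
    have "pencil_form d A Y (\<lambda>b. P *\<^sub>v w b) (\<lambda>b. P *\<^sub>v w b) = 0"
      using w(2) pencil_form_compress[where w = w and w' = w, OF Y(1) P w(1) w(1)] by simp
    then have "pencil_form d A Y ?w' (\<lambda>b. P *\<^sub>v w b) = 0"
      using q Pw by (intro pencil_form_null[where w = "\<lambda>b. P *\<^sub>v w b" and w' = ?w', OF A Y]) simp_all
    moreover have "?w' a' \<bullet> (P *\<^sub>v w a') = 0" for a'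
    proof -
      have "(P *\<^sub>v w a') \<bullet> q = 0"
        using scalar_prod_adjoint[OF P(1) w(1) q(1), of a'] q(2) w(1) by simp
      then have "q \<bullet> (P *\<^sub>v w a') = 0"
        using comm_scalar_prod[OF q(1) Pw] by simp
      then show ?thesis using q(1) Pw by simp
    qed
    moreover have "?w' a' \<bullet> (Y i *\<^sub>v (P *\<^sub>v w b)) = of_bool (a' = a) * (\<beta> i \<bullet> w b)" for a' b i
    proof -
      have "q \<bullet> (Y i *\<^sub>v (P *\<^sub>v w b)) = (P *\<^sub>v w b) \<bullet> (Y i *\<^sub>v q)"
        by (rule symmetric_scalar_prod[OF Yc SM_level_sym[OF Y(1)] q(1) Pw])
      also have "\<dots> = w b \<bullet> \<beta> i"
        unfolding \<beta>_def using Yc[of i] q by (intro scalar_prod_adjoint[OF P(1) w(1)]) auto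
      also have "\<dots> = \<beta> i \<bullet> w b" by (rule comm_scalar_prod[OF w(1) \<beta>])
      finally show ?thesis
        using q(1) mult_mat_vec_carrier[OF Yc Pw] by simp
    qed
    ultimately have "(\<Sum>i\<in>UNIV. \<Sum>a'<d. \<Sum>b<d. A i $$ (a', b) * (of_bool (a' = a) * (\<beta> i \<bullet> w b))) = 0"
      by (simp add: pencil_form_def pencil_lin_def)
    moreover have "(\<Sum>a'<d. \<Sum>b<d. A i $$ (a', b) * (of_bool (a' = a) * (\<beta> i \<bullet> w b))) =
        (\<Sum>a'<d. if a' = a then \<Sum>b<d. A i $$ (a', b) * (\<beta> i \<bullet> w b) else 0)" for i
      by (intro sum.cong refl) auto
    ultimately show ?thesis using a by simp
  qed
  \<comment> \<open>A null vector \<open>u\<close> at \<gamma> is also null at the point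
    \<open>f\<close> of \<open>F\<close> that \<open>x\<close> sees, so the tensor of
    \<open>u\<close> and \<open>x\<close> is a null family for \<open>compress P Y\<close> and
    \<open>ker_X\<close> applies.\<close>
  have ker_\<gamma>: "(\<Sum>i\<in>UNIV. \<Sum>b<d. A i $$ (a, b) * (u b * (\<beta> i \<bullet> x))) = 0"
    if u: "scalar_pencil_form d A \<gamma> u u = 0" and x: "x \<in> carrier_vec n" and a: "a < d" for u x a
  proof (cases "x = 0\<^sub>v n")
    case True
    then show ?thesis using \<beta> by simp
  next
    case False
    then obtain f where f: "f \<in> F" "numval ?X x = (x \<bullet> x) *\<^sub>R f"
      using numval_face_multiple[OF XS X x] by blast
    have "pencil_form d A ?X (\<lambda>b. u b \<cdot>\<^sub>v x) (\<lambda>b. u b \<cdot>\<^sub>v x) = 0"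
      unfolding pencil_form_tensor[OF XS x f(2)] scalar_pencil_form_kernel_face[OF \<gamma> f(1) u] by simp
    then have "(\<Sum>i\<in>UNIV. \<Sum>b<d. A i $$ (a, b) * (\<beta> i \<bullet> (u b \<cdot>\<^sub>v x))) = 0"
      using x by (intro ker_X a) auto
    then show ?thesis using x \<beta> by simp
  qed
  have dir: "\<exists>\<epsilon>>0. \<gamma> + \<epsilon> *\<^sub>R vec_lambda (\<lambda>i. \<beta> i \<bullet> x) \<in> F" if x: "x \<in> carrier_vec n" for x
  proof -
    have "scalar_pencil_lin d A (vec_lambda (\<lambda>i. \<beta> i \<bullet> x)) c u = 0"
      if u: "scalar_pencil_form d A \<gamma> u u = 0" for u c
    proof -
      have "scalar_pencil_lin d A (vec_lambda (\<lambda>i. \<beta> i \<bullet> x)) c u =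
          (\<Sum>i\<in>UNIV. \<Sum>a<d. c a * (\<Sum>b<d. A i $$ (a, b) * (u b * (\<beta> i \<bullet> x))))"
        by (simp add: scalar_pencil_lin_def sum_distrib_left ac_simps)
      also have "\<dots> = (\<Sum>a<d. c a * (\<Sum>i\<in>UNIV. \<Sum>b<d. A i $$ (a, b) * (u b * (\<beta> i \<bullet> x))))"
        by (subst sum.swap) (simp add: sum_distrib_left)
      also have "\<dots> = 0" using ker_\<gamma>[OF u x] by simp
      finally show ?thesis .
    qed
    then show ?thesis using face_direction[OF \<gamma>F] by metis
  qed

  define b where "b i = mat n 1 (\<lambda>(r, _). \<beta> i $ r)" for i
  have b: "b i \<in> carrier_mat n 1" for i by (simp add: b_def)
  have bv: "b i *\<^sub>v z = z $ 0 \<cdot>\<^sub>v \<beta> i" if "z \<in> carrier_vec 1" for i z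
    using that \<beta>[of i] by (intro eq_vecI) (auto simp: b_def scalar_prod_def)
  let ?\<gamma> = "scalar_tuple \<gamma>" and ?O = "\<lambda>_ :: 'h. 0\<^sub>m n n :: real mat" and ?O1 = "\<lambda>_ :: 'h. 0\<^sub>m 1 1 :: real mat"
  have O: "?O \<in> SM_level n" "?O1 \<in> SM_level 1" by (auto simp: SM_level_def)
  let ?D = "direct_sum ?X ?\<gamma>"
  \<comment> \<open>The pure off-diagonal direction: the dilation \<open>?E\<close> below is
    \<open>?D + t M\<close>.\<close>
  define M where "M = block_tuple ?O b ?O1"
  have D: "?D \<in> SM_level (n + 1)" by (rule direct_sum_SM_level[OF XS scalar_tuple_SM_level])
  have B: "M \<in> SM_level (n + 1)" unfolding M_def by (rule block_tuple_SM_level[OF O(1) b O(2)])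
  have D_form: "pencil_form d A ?D (\<lambda>a. x a @\<^sub>v z a) (\<lambda>a. x' a @\<^sub>v z' a) =
      pencil_form d A ?X x x' + scalar_pencil_form d A \<gamma> (\<lambda>a. z a $ 0) (\<lambda>a. z' a $ 0)"
    if "\<And>a. x a \<in> carrier_vec n" "\<And>a. x' a \<in> carrier_vec n" "\<And>a. z a \<in> carrier_vec 1" "\<And>a. z' a \<in> carrier_vec 1"
    for x x' z z'
  proof -
    have "(x a @\<^sub>v z a) \<bullet> (x' a @\<^sub>v z' a) = x a \<bullet> x' a + z a \<bullet> z' a" for a
      using that by (intro scalar_prod_append)
    then have "pencil_form d A ?D (\<lambda>a. x a @\<^sub>v z a) (\<lambda>a. x' a @\<^sub>v z' a) =
        pencil_form d A ?X x x' + pencil_form d A ?\<gamma> z z'"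
      using that by (simp add: pencil_form_def pencil_lin_def direct_sum_scalar_prod[OF XS scalar_tuple_SM_level]
          sum.distrib distrib_left)
    then show ?thesis using that by (simp add: pencil_form_scalar_tuple)
  qed
  have B_entry: "(x @\<^sub>v z) \<bullet> (M i *\<^sub>v (x' @\<^sub>v z')) = z' $ 0 * (\<beta> i \<bullet> x) + z $ 0 * (\<beta> i \<bullet> x')"
    if "x \<in> carrier_vec n" "x' \<in> carrier_vec n" "z \<in> carrier_vec 1" "z' \<in> carrier_vec 1" for x x' z z' i
    unfolding M_def block_tuple_scalar_prod[where b = b, OF O(1) b O(2) that]
    using that \<beta> comm_scalar_prod[OF that(1) \<beta>]
    by (simp add: zero_mult_mat_vec[of _ n] zero_mult_mat_vec[of _ "Suc 0"] bv)
  have split: "\<exists>x z. (\<forall>a. x a \<in> carrier_vec n) \<and> (\<forall>a. z a \<in> carrier_vec 1) \<and> w = (\<lambda>a. x a @\<^sub>v z a)"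
    if "\<And>a. w a \<in> carrier_vec (n + 1)" for w :: "nat \<Rightarrow> real vec"
    using that
    by (intro exI[of _ "\<lambda>a. vec_first (w a) n"] exI[of _ "\<lambda>a. vec_last (w a) 1"]) auto
  have DK: "?D \<in> ?K"
    unfolding mem_free_spectrahedron_iff[OF A D]
  proof (intro conjI allI impI)
    fix w :: "nat \<Rightarrow> real vec" assume "\<forall>a. w a \<in> carrier_vec (n + 1)"
    then obtain x z where xz: "\<And>a. x a \<in> carrier_vec n" "\<And>a. z a \<in> carrier_vec 1" "w = (\<lambda>a. x a @\<^sub>v z a)"
      using split[of w] by blast
    have "0 \<le> pencil_form d A ?X x x"
      using XK xz(1) unfolding mem_free_spectrahedron_iff[OF A XS] by simp
    then show "0 \<le> pencil_form d A ?D w w"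
      unfolding xz(3) using D_form[of x x z z] xz \<gamma>K by simp
  qed simp
  \<comment> \<open>Both forms being nonnegative, a null family of the direct sum has null
    components; the part of \<open>M\<close> that meets \<open>x\<close> dies by
    \<open>ker_X\<close>, the part that meets \<open>z\<close> by
    \<open>ker_\<gamma>\<close>.\<close>
  have ker_D: "pencil_lin d A M w' w = 0"
    if w: "\<And>a. w a \<in> carrier_vec (n + 1)" "\<And>a. w' a \<in> carrier_vec (n + 1)" "pencil_form d A ?D w w = 0" for w w'
  proof -
    obtain x z where xz: "\<And>a. x a \<in> carrier_vec n" "\<And>a. z a \<in> carrier_vec 1" "w = (\<lambda>a. x a @\<^sub>v z a)"
      using split[of w] w(1) by blast
    obtain x' z' where xz': "\<And>a. x' a \<in> carrier_vec n" "\<And>a. z' a \<in> carrier_vec 1" "w' = (\<lambda>a. x' a @\<^sub>v z' a)"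
      using split[of w'] w(2) by blast
    have "0 \<le> pencil_form d A ?X x x"
      using XK xz(1) unfolding mem_free_spectrahedron_iff[OF A XS] by simp
    then have zero: "pencil_form d A ?X x x = 0" "scalar_pencil_form d A \<gamma> (\<lambda>a. z a $ 0) (\<lambda>a. z a $ 0) = 0"
      using w(3) D_form[of x x z z] xz \<gamma>K[rule_format, of "\<lambda>a. z a $ 0"] by auto
    have "pencil_lin d A M w' w = (\<Sum>i\<in>UNIV. \<Sum>a<d. \<Sum>b<d.
        A i $$ (a, b) * (z b $ 0 * (\<beta> i \<bullet> x' a)) + z' a $ 0 * (A i $$ (a, b) * (\<beta> i \<bullet> x b)))"
      unfolding pencil_lin_def xz(3) xz'(3)
      unfolding B_entry[OF xz'(1) xz(1) xz'(2) xz(2)] by (simp add: algebra_simps)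
    also have "\<dots> = (\<Sum>a<d. \<Sum>i\<in>UNIV. \<Sum>b<d.
        A i $$ (a, b) * (z b $ 0 * (\<beta> i \<bullet> x' a)) + z' a $ 0 * (A i $$ (a, b) * (\<beta> i \<bullet> x b)))"
      by (rule sum.swap)
    also have "\<dots> = (\<Sum>a<d. (\<Sum>i\<in>UNIV. \<Sum>b<d. A i $$ (a, b) * (z b $ 0 * (\<beta> i \<bullet> x' a))) +
        z' a $ 0 * (\<Sum>i\<in>UNIV. \<Sum>b<d. A i $$ (a, b) * (\<beta> i \<bullet> x b)))"
      by (simp add: sum.distrib sum_distrib_left)
    also have "\<dots> = 0"
      using ker_\<gamma>[OF zero(2) xz'(1)] ker_X[OF xz(1) zero(1)] by simp
    finally show ?thesis .
  qed
  obtain t where t: "t > 0" "\<And>s w. \<bar>s\<bar> \<le> t \<Longrightarrow> (\<And>a. w a \<in> carrier_vec (n + 1)) \<Longrightarrow>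
       0 \<le> pencil_form d A ?D w w - s * pencil_lin d A M w w"
    using pencil_perturbation[OF A D DK B] ker_D by metis

  let ?b = "\<lambda>i. t \<cdot>\<^sub>m b i"
  have tb: "?b i \<in> carrier_mat n 1" for i using b by simp
  have tbv: "?b i *\<^sub>v z = (t * z $ 0) \<cdot>\<^sub>v \<beta> i" if "z \<in> carrier_vec 1" for i z
    using that \<beta>[of i] by (intro eq_vecI) (auto simp: b_def scalar_prod_def)
  let ?E = "block_tuple ?X ?b ?\<gamma>"
  have E: "?E \<in> SM_level (n + 1)"
    by (rule block_tuple_SM_level[where b = ?b, OF XS tb scalar_tuple_SM_level])
  have E_entry: "(x @\<^sub>v z) \<bullet> (?E i *\<^sub>v (x' @\<^sub>v z')) =
      x \<bullet> (?X i *\<^sub>v x') + z $ 0 * z' $ 0 * vec_nth \<gamma> i + t * (z' $ 0 * (\<beta> i \<bullet> x) + z $ 0 * (\<beta> i \<bullet> x'))"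
    if "x \<in> carrier_vec n" "x' \<in> carrier_vec n" "z \<in> carrier_vec 1" "z' \<in> carrier_vec 1" for x x' z z' i
    unfolding block_tuple_scalar_prod[where b = ?b, OF XS tb scalar_tuple_SM_level that]
    using that \<beta> comm_scalar_prod[OF that(1) \<beta>]
    by (simp add: tbv scalar_tuple_scalar_prod algebra_simps)
  have "pencil_form d A ?E w w = pencil_form d A ?D w w - t * pencil_lin d A M w w"
    if w: "\<And>a. w a \<in> carrier_vec (n + 1)" for w
  proof -
    obtain x z where xz: "\<And>a. x a \<in> carrier_vec n" "\<And>a. z a \<in> carrier_vec 1" "w = (\<lambda>a. x a @\<^sub>v z a)"
      using split[of w] w by blast
    have "w a \<bullet> (?E i *\<^sub>v w c) = w a \<bullet> (?D i *\<^sub>v w c) + t * (w a \<bullet> (M i *\<^sub>v w c))" for a c i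
      unfolding xz(3) E_entry[OF xz(1) xz(1) xz(2) xz(2)] B_entry[OF xz(1) xz(1) xz(2) xz(2)]
        direct_sum_scalar_prod[OF XS scalar_tuple_SM_level xz(1) xz(1) xz(2) xz(2)]
        scalar_tuple_scalar_prod[OF xz(2) xz(2)] by simp
    then have "pencil_lin d A ?E w w = pencil_lin d A ?D w w + t * pencil_lin d A M w w"
      by (simp add: pencil_lin_def sum.distrib sum_distrib_left algebra_simps)
    then show ?thesis by (simp add: pencil_form_def)
  qed
  then have EK: "?E \<in> ?K"
    unfolding mem_free_spectrahedron_iff[OF A E] using t by simp
  have "numval ?E v \<in> affine hull F" if v: "v \<in> carrier_vec (n + 1)" "v \<bullet> v = 1" for v
  proof -
    define x z where "x = vec_first v n" and "z = vec_last v 1"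
    have xz: "x \<in> carrier_vec n" "z \<in> carrier_vec 1" "v = x @\<^sub>v z"
      using v(1) by (auto simp: x_def z_def)
    have one: "x \<bullet> x + z $ 0 * z $ 0 = 1"
      using v(2) scalar_prod_append[OF xz(1,2,1,2)] xz(2,3) by (simp add: scalar_prod_dim_1)
    obtain \<epsilon> where \<epsilon>: "\<epsilon> > 0" "\<gamma> + \<epsilon> *\<^sub>R vec_lambda (\<lambda>i. \<beta> i \<bullet> x) \<in> F"
      using dir[OF xz(1)] by blast
    obtain f where f: "f \<in> F" "numval ?X x = (x \<bullet> x) *\<^sub>R f"
    proof (cases "x = 0\<^sub>v n")
      \<comment> \<open>The weight \<open>x \<bullet> x\<close> is zero here, so any point of
        \<open>F\<close> will do.\<close>
      case True
      then show ?thesis using that[OF \<gamma>F] numval_zero[OF XS] by simp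
    qed (use numval_face_multiple[OF XS X xz(1)] that in blast)
    let ?g = "\<gamma> + \<epsilon> *\<^sub>R vec_lambda (\<lambda>i. \<beta> i \<bullet> x)"
    \<comment> \<open>Chosen so that \<open>s (?g - \<gamma>)\<close> is the off-diagonal
      contribution. As \<open>s\<close> may be negative, the combination is affine and in general
      not convex.\<close>
    define s where "s = 2 * t * z $ 0 / \<epsilon>"
    have "numval ?E v = numval ?X x + (z $ 0 * z $ 0) *\<^sub>R \<gamma> + (2 * t * z $ 0) *\<^sub>R vec_lambda (\<lambda>i. \<beta> i \<bullet> x)"
      by (simp add: Finite_Cartesian_Product.vec_eq_iff xz(3) E_entry[OF xz(1,1,2,2)])
    also have "\<dots> = (x \<bullet> x) *\<^sub>R f + (z $ 0 * z $ 0 - s) *\<^sub>R \<gamma> + s *\<^sub>R ?g"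
      using \<epsilon>(1) f(2) by (simp add: s_def algebra_simps)
    also have "\<dots> \<in> affine hull F"
      using f(1) \<gamma>F \<epsilon>(2) one by (intro mem_affine_3) (auto intro: hull_inc)
    finally show ?thesis .
  qed
  then have EG: "?E \<in> level (graded_lift ?K F) (n + 1)"
    using EK E aff_matI_numval[OF E] by (simp add: level_def graded_lift_def)

  \<comment> \<open>The inclusion of the first \<open>n\<close> coordinates recovers
    \<open>compress P Y\<close> from \<open>?E\<close>. Since \<open>?E\<close> has size
    \<open>n + 1\<close>, extremality leaves only the alternative with a complement
    \<open>Z\<close>.\<close>
  define J where "J = 1\<^sub>m n @\<^sub>r (0\<^sub>m 1 n :: real mat)"
  have J: "J \<in> carrier_mat (n + 1) n" unfolding J_def by (intro carrier_append_rows) auto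
  have Jv: "J *\<^sub>v x = x @\<^sub>v 0\<^sub>v 1" if "x \<in> carrier_vec n" for x
    using mat_mult_append[of "1\<^sub>m n" n n "0\<^sub>m 1 n" 1 x] that by (simp add: J_def zero_mult_mat_vec)
  have JJ: "J\<^sup>T * J = 1\<^sub>m n"
  proof (rule eq_mat_by_scalar_prod[of _ n n])
    fix x y :: "real vec" assume xy: "x \<in> carrier_vec n" "y \<in> carrier_vec n"
    have "x \<bullet> (J\<^sup>T * J *\<^sub>v y) = (J *\<^sub>v x) \<bullet> (J *\<^sub>v y)"
      using J xy by (simp add: scalar_prod_adjoint[OF J xy(1)] assoc_mult_mat_vec[of _ n "n + 1" _ n])
    also have "\<dots> = x \<bullet> y"
      using xy by (simp add: Jv scalar_prod_append[of _ n _ 1])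
    finally show "x \<bullet> (J\<^sup>T * J *\<^sub>v y) = x \<bullet> (1\<^sub>m n *\<^sub>v y)" using xy by simp
  qed (use J in auto)
  have "compress J ?E = ?X"
  proof
    fix i
    show "compress J ?E i = ?X i"
    proof (rule eq_mat_by_scalar_prod[of _ n n])
      fix x y :: "real vec" assume xy: "x \<in> carrier_vec n" "y \<in> carrier_vec n"
      then show "x \<bullet> (compress J ?E i *\<^sub>v y) = x \<bullet> (?X i *\<^sub>v y)"
        unfolding compress_scalar_prod[OF E J xy] by (simp add: Jv E_entry)
    qed (use SM_level_carrier[OF compress_SM_level[OF E J]] SM_level_carrier[OF XS] in auto)
  qed
  then have "mat_conv_comb (graded_lift ?K F) n 1 (\<lambda>_. n + 1) (\<lambda>_. J) (\<lambda>_. ?E) ?X"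
    using mat_conv_comb_single[OF EG J JJ] by simp
  moreover have "J \<noteq> 0\<^sub>m (n + 1) n"
  proof
    assume "J = 0\<^sub>m (n + 1) n"
    then have "1\<^sub>m n = (0\<^sub>m n n :: real mat)" using JJ by simp
    then have "(1\<^sub>m n :: real mat) $$ (0, 0) = 0\<^sub>m n n $$ (0, 0)" by simp
    then show False using n by simp
  qed
  ultimately obtain Z where Z: "Z \<in> graded_lift ?K F" "direct_sum ?X Z \<sim>\<^sub>u ?E"
    using free_extreme_pointD[OF ext XS, of 1 "\<lambda>_. n + 1" "\<lambda>_. J" "\<lambda>_. ?E" 0] by auto
  obtain k where "Z \<in> SM_level k"
    using Z(1) free_spectrahedron_SM_level unfolding graded_lift_def by blast
  then have b0: "?b i = 0\<^sub>m n 1"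
    using orth_equiv_block_tuple[where b = ?b, OF XS tb scalar_tuple_SM_level _ Z(2)] by blast
  have "\<beta> i $ r = 0" if "r < n" for r
  proof -
    have "?b i $$ (r, 0) = 0\<^sub>m n 1 $$ (r, 0)" by (simp only: b0)
    then show ?thesis using that t(1) by (simp add: b_def)
  qed
  then have "\<beta> i = 0\<^sub>v n"
    using \<beta>[of i] by (intro eq_vecI) auto
  then show ?thesis by (simp only: \<beta>_def)
qed

text \<open>Each \<open>V j\<close> factors as \<open>P j * R j\<close> through its range, and the
  combination is rewritten with coefficients \<open>R j\<close> and the compressions of the
  \<open>Y j\<close>. Their sizes are at most \<open>n\<close>, so extremality must identify the
  compression at hand with \<open>X\<close> up to rotation.\<close>

lemma free_extreme_point_lift_imp:
  assumes F: "F \<noteq> {}" and X: "X \<in> graded_lift (free_spectrahedron d A) F"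
    and ext: "free_extreme_point (graded_lift (free_spectrahedron d A) F) X"
  shows "free_extreme_point (free_spectrahedron d A) X"
proof -
  let ?K = "free_spectrahedron d A" and ?G = "graded_lift (free_spectrahedron d A) F"
  obtain n where n: "1 \<le> n" "X \<in> SM_level n"
    using X free_spectrahedron_SM_level unfolding graded_lift_def by blast
  have "(N l = n \<and> X \<sim>\<^sub>u Y l) \<or> (N l > n \<and> (\<exists>Z\<in>?K. direct_sum X Z \<sim>\<^sub>u Y l))"
    if comb: "mat_conv_comb ?K n m N V Y X" and nz: "\<forall>l<m. V l \<noteq> 0\<^sub>m (N l) n" and l: "l < m" for m N V Y l
  proof -
    have Y: "Y j \<in> SM_level (N j)" "Y j \<in> ?K" and V: "V j \<in> carrier_mat (N j) n" if "j < m" for j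
      using comb that by (auto simp: mat_conv_comb_def level_def)
    have "\<exists>k P S. k \<le> n \<and> P \<in> carrier_mat (N j) k \<and> S \<in> carrier_mat n k \<and> P = V j * S \<and>
        P\<^sup>T * P = 1\<^sub>m k \<and> P * (P\<^sup>T * V j) = V j" if "j < m" for j
      using isometry_range[OF V[OF that]] by metis
    then obtain k P S where kPS: "\<And>j. j < m \<Longrightarrow> k j \<le> n \<and> P j \<in> carrier_mat (N j) (k j) \<and>
        S j \<in> carrier_mat n (k j) \<and> P j = V j * S j \<and> (P j)\<^sup>T * P j = 1\<^sub>m (k j) \<and>
        P j * ((P j)\<^sup>T * V j) = V j"
      by metis
    define R where "R j = (P j)\<^sup>T * V j" for j
    have R: "R j \<in> carrier_mat (k j) n" and PR: "P j * R j = V j" if "j < m" for j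
      using kPS[OF that] V[OF that] by (auto simp: R_def)
    have RR: "(R j)\<^sup>T * R j = (V j)\<^sup>T * V j" if "j < m" for j
    proof -
      have P: "P j \<in> carrier_mat (N j) (k j)" "(P j)\<^sup>T \<in> carrier_mat (k j) (N j)" using kPS[OF that] by auto
      have "(R j)\<^sup>T = (V j)\<^sup>T * P j"
        unfolding R_def using P V[OF that] by (simp add: transpose_mult[of _ "k j" "N j"])
      then have "(R j)\<^sup>T * R j = (V j)\<^sup>T * (P j * R j)"
        using P V[OF that] R[OF that] by (simp add: assoc_mult_mat[of _ n "N j" _ "k j" _ n])
      then show ?thesis by (simp add: PR[OF that])
    qed
    have R0: "R j \<noteq> 0\<^sub>m (k j) n" if "j < m" for j
    proof
      assume "R j = 0\<^sub>m (k j) n"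
      then have "V j = 0\<^sub>m (N j) n" using PR[OF that] kPS[OF that] by auto
      then show False using nz that by blast
    qed
    \<comment> \<open>A range of dimension zero would make the coefficient zero, and the lift has no
      tuples of size zero.\<close>
    have k: "1 \<le> k j" if "j < m" for j
    proof (rule ccontr)
      assume "\<not> 1 \<le> k j"
      then have "R j = 0\<^sub>m (k j) n" using R[OF that] by (intro eq_matI) auto
      then show False using R0[OF that] by simp
    qed
    define Y' where "Y' j = compress (P j) (Y j)" for j
    have Y': "Y' j \<in> level ?G (k j)" if "j < m" for j
      unfolding Y'_def using kPS[OF that] k[OF that]
      by (intro compress_range_mem_graded_lift[OF comb X that, of _ "S j"]) auto
    have RY': "compress (R j) (Y' j) = compress (V j) (Y j)" if "j < m" for j
    proof -
      have "P j \<in> carrier_mat (N j) (k j)" using kPS[OF that] by blast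
      then show ?thesis
        unfolding Y'_def using compress_compress[OF Y(1)[OF that] _ R[OF that]] PR[OF that] by metis
    qed
    have cong: "mat_sum n M {..<m} = mat_sum n M' {..<m}" if "\<And>j. j < m \<Longrightarrow> M j = M' j" for M M' :: "nat \<Rightarrow> real mat"
      using that by (simp add: mat_sum_def)
    have "mat_sum n (\<lambda>j. (R j)\<^sup>T * R j) {..<m} = 1\<^sub>m n"
      using cong[OF RR] comb by (simp add: mat_conv_comb_def)
    moreover have "X = (\<lambda>i. mat_sum n (\<lambda>j. compress (R j) (Y' j) i) {..<m})"
    proof -
      have "mat_sum n (\<lambda>j. compress (R j) (Y' j) i) {..<m} = mat_sum n (\<lambda>j. compress (V j) (Y j) i) {..<m}" for i
        by (intro cong) (simp add: RY')
      then show ?thesis using comb by (simp add: mat_conv_comb_def)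
    qed
    ultimately have "mat_conv_comb ?G n m k R Y' X"
      using Y' R by (simp add: mat_conv_comb_def)
    then have "(k l = n \<and> X \<sim>\<^sub>u Y' l) \<or> (k l > n \<and> (\<exists>Z\<in>?G. direct_sum X Z \<sim>\<^sub>u Y' l))"
      using free_extreme_pointD[OF ext n(2), of m k R Y' l] R0 l by blast
    then have kl: "k l = n" "X \<sim>\<^sub>u Y' l" using kPS[OF l] by auto
    have P: "P l \<in> carrier_mat (N l) n" "(P l)\<^sup>T * P l = 1\<^sub>m n" using kPS[OF l] kl by auto
    obtain U where U: "U \<in> carrier_mat n n" "U\<^sup>T * U = 1\<^sub>m n" "U * U\<^sup>T = 1\<^sub>m n" "compress U X = Y' l"
      using orth_equivE[OF kl(2) n(2)] by blast
    \<comment> \<open>Undoing the rotation makes \<open>Y l\<close> a dilation of \<open>X\<close>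
      itself, the form in which \<open>dilation_trivial\<close> and the direct sum are
      stated.\<close>
    define W where "W = P l * U\<^sup>T"
    have UT: "U\<^sup>T \<in> carrier_mat n n" using U by simp
    have W: "W \<in> carrier_mat (N l) n" using P UT by (simp add: W_def)
    have WX: "compress W (Y l) = X"
    proof -
      have "compress W (Y l) = compress (U\<^sup>T) (compress U X)"
        unfolding W_def using compress_compress[OF Y(1)[OF l] P(1) UT] U(4) by (simp add: Y'_def)
      also have "\<dots> = X"
        unfolding compress_compress[OF n(2) U(1) UT] U(3) by (rule compress_one[OF n(2)])
      finally show ?thesis .
    qed
    have WW: "W\<^sup>T * W = 1\<^sub>m n"
    proof (rule eq_mat_by_scalar_prod[of _ n n])
      fix x y :: "real vec" assume xy: "x \<in> carrier_vec n" "y \<in> carrier_vec n"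
      then have Uxy: "U\<^sup>T *\<^sub>v x \<in> carrier_vec n" "U\<^sup>T *\<^sub>v y \<in> carrier_vec n" using UT by auto
      have "x \<bullet> (W\<^sup>T * W *\<^sub>v y) = (W *\<^sub>v x) \<bullet> (W *\<^sub>v y)"
        using W xy by (simp add: scalar_prod_adjoint[OF W xy(1)] assoc_mult_mat_vec[of _ n "N l" _ n])
      also have "\<dots> = (U\<^sup>T *\<^sub>v x) \<bullet> (U\<^sup>T *\<^sub>v y)"
        unfolding W_def assoc_mult_mat_vec[OF P(1) UT xy(1)] assoc_mult_mat_vec[OF P(1) UT xy(2)]
        by (rule isometry_scalar_prod[OF P Uxy])
      also have "\<dots> = x \<bullet> y"
        using U(1,3) xy by (intro isometry_scalar_prod[of _ n n]) auto
      finally show "x \<bullet> (W\<^sup>T * W *\<^sub>v y) = x \<bullet> (1\<^sub>m n *\<^sub>v y)" using xy by simp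
    qed (use W in auto)
    have red: "W\<^sup>T *\<^sub>v (Y l i *\<^sub>v q) = 0\<^sub>v n" if "q \<in> carrier_vec (N l)" "W\<^sup>T *\<^sub>v q = 0\<^sub>v n" for i q
      using dilation_trivial[OF F Y[OF l] W WW n(1) _ _ that] X ext unfolding WX by blast
    show ?thesis
      using isometry_reducing_direct_sum[OF Y(1)[OF l] W WW red]
        free_spectrahedron_compress[OF A Y[OF l]] unfolding WX by blast
  qed
  then show ?thesis
    using n X by (intro free_extreme_pointI[OF n(1)]) (simp_all add: level_def graded_lift_def)
qed

end

text \<open>The value of \<open>Z\<close> at \<open>z\<close> is that of the direct sum at
  \<open>z\<close> padded with zeros, and an orthogonal equivalence only moves unit vectors to unit
  vectors; so the values of \<open>Z\<close> are among those of \<open>Y\<close>.\<close>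

lemma aff_mat_direct_summand:
  assumes Y: "Y \<in> aff_mat F" and X: "X \<in> SM_level n" and Z: "Z \<in> SM_level k" "1 \<le> k"
    and equiv: "direct_sum X Z \<sim>\<^sub>u Y"
  shows "Z \<in> aff_mat F"
proof (rule aff_matI_numval[OF Z])
  fix z :: "real vec" assume z: "z \<in> carrier_vec k" "z \<bullet> z = 1"
  let ?S = "direct_sum X Z" and ?v = "0\<^sub>v n @\<^sub>v z"
  have S: "?S \<in> SM_level (n + k)" by (rule direct_sum_SM_level[OF X Z(1)])
  obtain U where U: "U \<in> carrier_mat (n + k) (n + k)" "U\<^sup>T * U = 1\<^sub>m (n + k)" "U * U\<^sup>T = 1\<^sub>m (n + k)"
    "compress U ?S = Y"
    using orth_equivE[OF equiv S] by blast
  have Y': "Y \<in> SM_level (n + k)" using compress_SM_level[OF S U(1)] U(4) by simp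
  have v: "?v \<in> carrier_vec (n + k)" using z by simp
  have UT: "U\<^sup>T \<in> carrier_mat (n + k) (n + k)" using U by simp
  let ?y = "U\<^sup>T *\<^sub>v ?v"
  have y: "?y \<in> carrier_vec (n + k)" by (rule mult_mat_vec_carrier[OF UT v])
  have Uy: "U *\<^sub>v ?y = ?v"
    using assoc_mult_mat_vec[OF U(1) UT v] U(3) v by simp
  have "?y \<bullet> ?y = ?v \<bullet> ?v"
    using U(3) by (intro isometry_scalar_prod[OF UT _ v v]) simp
  also have "\<dots> = 1" using z by (subst scalar_prod_append[of _ n _ k]) auto
  finally have "numval Y ?y \<in> affine hull F" by (rule aff_mat_numval[OF Y Y' y])
  moreover have "numval Y ?y = numval ?S ?v"
    unfolding U(4)[symmetric] numval_compress[OF S U(1) y] Uy ..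
  moreover have "numval ?S ?v = numval Z z"
    using scalar_prod_left_zero[OF mult_mat_vec_carrier[OF SM_level_carrier[OF X] zero_carrier_vec]] z
    by (simp add: Finite_Cartesian_Product.vec_eq_iff direct_sum_scalar_prod[OF X Z(1)])
  ultimately show "numval Z z \<in> affine hull F" by simp
qed

lemma free_extreme_point_imp_lift:
  assumes X: "X \<in> graded_lift (free_spectrahedron d A) F"
    and ext: "free_extreme_point (free_spectrahedron d A) X"
  shows "free_extreme_point (graded_lift (free_spectrahedron d A) F) X"
proof -
  let ?K = "free_spectrahedron d A" and ?G = "graded_lift (free_spectrahedron d A) F"
  obtain n where n: "1 \<le> n" "X \<in> SM_level n"
    using X free_spectrahedron_SM_level unfolding graded_lift_def by blast
  have "(N l = n \<and> X \<sim>\<^sub>u Y l) \<or> (N l > n \<and> (\<exists>Z\<in>?G. direct_sum X Z \<sim>\<^sub>u Y l))"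
    if comb: "mat_conv_comb ?G n m N V Y X" and nz: "\<forall>l<m. V l \<noteq> 0\<^sub>m (N l) n" and l: "l < m" for m N V Y l
  proof -
    have "mat_conv_comb ?K n m N V Y X"
      using comb by (auto simp: mat_conv_comb_def level_def graded_lift_def)
    then have "(N l = n \<and> X \<sim>\<^sub>u Y l) \<or> (N l > n \<and> (\<exists>Z\<in>?K. direct_sum X Z \<sim>\<^sub>u Y l))"
      using free_extreme_pointD[OF ext n(2), of m N V Y l] nz l by blast
    moreover have "Z \<in> ?G" if Z: "Z \<in> ?K" "direct_sum X Z \<sim>\<^sub>u Y l" for Z
    proof -
      obtain k where k: "1 \<le> k" "Z \<in> SM_level k" using free_spectrahedron_SM_level[OF Z(1)] by blast
      have "Y l \<in> aff_mat F" using comb l by (auto simp: mat_conv_comb_def level_def graded_lift_def)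
      then show ?thesis
        using aff_mat_direct_summand[OF _ n(2) k(2,1) Z(2)] Z(1) by (simp add: graded_lift_def)
    qed
    ultimately show ?thesis by blast
  qed
  then show ?thesis
    using n X by (intro free_extreme_pointI[OF n(1)]) (simp_all add: level_def)
qed

theorem corollary4p5:
  fixes A X :: "'h::finite \<Rightarrow> real mat"
    and F :: "(real ^ 'h) set"
    and g d :: nat
  assumes "1 \<le> g" and "g < CARD('h)"
    and "1 \<le> d" and "A \<in> SM_level d"
    and "mat_bounded (free_spectrahedron d A)"
    and "F face_of level_one (free_spectrahedron d A)"
    and "aff_dim F = int g"
    and "X \<in> graded_lift (free_spectrahedron d A) F"
  shows "free_extreme_point (graded_lift (free_spectrahedron d A) F) X
     \<longleftrightarrow> free_extreme_point (free_spectrahedron d A) X"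
proof
  \<comment> \<open>The empty set has affine dimension -1, whereas \<open>g\<close> is a natural
    number.\<close>
  have "F \<noteq> {}" using assms(7) by auto
  then show "free_extreme_point (free_spectrahedron d A) X"
    if "free_extreme_point (graded_lift (free_spectrahedron d A) F) X"
    by (rule free_extreme_point_lift_imp[OF assms(4,6) _ assms(8) that])
qed (rule free_extreme_point_imp_lift[OF assms(8)])

end
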